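(* Let $n=p+q$ with $p\ge q$ and fix $\eta\in\{j,k\}$. For any $n\times n$ quaternionic orthogonal matrix $O\in\mathbb{H}^{n\times n}$ such that $O^{D_i}O=I_n$, there exist an $n\times n$ complex unitary matrix $U$, two quaternionic orthogonal matrices $V_p\in\mathbb{H}^{p\times p}$ and $V_q\in\mathbb{H}^{q\times q}$ with $V_p^{D_i}V_p=I_p$ and $V_q^{D_i}V_q=I_q$, and $q$ unique (up to order and signs) real numbers $\theta_1,\dots,\theta_q$ such that $$O=U\begin{bmatrix}Ch&0&\eta Sh\\0&I_{p-q}&0\\-\eta Sh&0&Ch\end{bmatrix}\begin{bmatrix}V_p&0\\0&V_q\end{bmatrix}.$$
   Context: $\mathbb{H}$ denotes the real quaternions with imaginary units $i,j,k$; complex matrices are regarded as quaternionic matrices with entries in $\mathbb{R}+i\mathbb{R}$. For a quaternionic square matrix $M$, $(M^D)_{ab}=\overline{M_{ba}}$ and $M^{D_i}=-iM^Di$. $Ch=\operatorname{diag}(\cosh\theta_1,\dots,\cosh\theta_q)$ and $Sh=\operatorname{diag}(\sinh\theta_1,\dots,\sinh\theta_q)$; the block sizes of the middle factor are $q,\,p-q,\,q$. *)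

theory Defs
  imports "Jordan_Normal_Form.Schur_Decomposition"
begin

section \<open>The ring of real quaternions\<close>

datatype quat = Quat (qRe: real) (qI: real) (qJ: real) (qK: real)

instantiation quat :: ring_1
begin

definition "0 = Quat 0 0 0 0"
definition "1 = Quat 1 0 0 0"
definition "x + y = Quat (qRe x + qRe y) (qI x + qI y) (qJ x + qJ y) (qK x + qK y)"
definition "- x = Quat (- qRe x) (- qI x) (- qJ x) (- qK x)"
definition "x - y = Quat (qRe x - qRe y) (qI x - qI y) (qJ x - qJ y) (qK x - qK y)"
definition "x * y = Quat
  (qRe x * qRe y - qI x * qI y - qJ x * qJ y - qK x * qK y)
  (qRe x * qI y + qI x * qRe y + qJ x * qK y - qK x * qJ y)
  (qRe x * qJ y - qI x * qK y + qJ x * qRe y + qK x * qI y)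
  (qRe x * qK y + qI x * qJ y - qJ x * qI y + qK x * qRe y)"

instance
  by standard
    (simp_all add: zero_quat_def one_quat_def plus_quat_def uminus_quat_def
      minus_quat_def times_quat_def quat.expand algebra_simps)

end

instantiation quat :: real_algebra_1
begin

definition "scaleR r x = Quat (r * qRe x) (r * qI x) (r * qJ x) (r * qK x)"

instance
  by standard
    (simp_all add: one_quat_def plus_quat_def times_quat_def scaleR_quat_def
      quat.expand algebra_simps)

end

definition quat_i :: quat where "quat_i = Quat 0 1 0 0"
definition quat_j :: quat where "quat_j = Quat 0 0 1 0"
definition quat_k :: quat where "quat_k = Quat 0 0 0 1"

lemma quat_units:
  "quat_i * quat_i = - 1" "quat_j * quat_j = - 1" "quat_k * quat_k = - 1"
  "quat_i * quat_j = quat_k" "quat_j * quat_k = quat_i" "quat_k * quat_i = quat_j"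
  "quat_j * quat_i = - quat_k" "quat_k * quat_j = - quat_i" "quat_i * quat_k = - quat_j"
  by (simp_all add: quat_i_def quat_j_def quat_k_def times_quat_def uminus_quat_def one_quat_def)

definition quat_cnj :: "quat \<Rightarrow> quat" where
  "quat_cnj x = Quat (qRe x) (- qI x) (- qJ x) (- qK x)"

definition quat_of_complex :: "complex \<Rightarrow> quat" where
  "quat_of_complex z = Quat (Re z) (Im z) 0 0"


section \<open>Quaternionic matrices\<close>

text \<open>
  The library's \<^const>\<open>mat_adjoint\<close> is restricted to commutative entries, so the
  quaternionic conjugate transpose is defined here.  Scalars in \<^const>\<open>smult_mat\<close>
  act from the left.
\<close>

definition quat_adjoint :: "quat mat \<Rightarrow> quat mat" where
  "quat_adjoint M = map_mat quat_cnj (transpose_mat M)"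

definition quat_adjoint_i :: "quat mat \<Rightarrow> quat mat" where
  "quat_adjoint_i M = map_mat (\<lambda>x. - quat_i * x * quat_i) (quat_adjoint M)"

definition quat_orthogonal :: "nat \<Rightarrow> quat mat \<Rightarrow> bool" where
  "quat_orthogonal n M \<longleftrightarrow> M \<in> carrier_mat n n \<and> quat_adjoint_i M * M = 1\<^sub>m n"

definition complex_unitary :: "nat \<Rightarrow> complex mat \<Rightarrow> bool" where
  "complex_unitary n U \<longleftrightarrow> U \<in> carrier_mat n n \<and> mat_adjoint U * U = 1\<^sub>m n"

definition Ch_mat :: "nat \<Rightarrow> real vec \<Rightarrow> quat mat" where
  "Ch_mat q \<theta> = mat_diag q (\<lambda>a. of_real (cosh (\<theta> $ a)))"

definition Sh_mat :: "nat \<Rightarrow> real vec \<Rightarrow> quat mat" where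
  "Sh_mat q \<theta> = mat_diag q (\<lambda>a. of_real (sinh (\<theta> $ a)))"

text \<open>
  The middle factor, with its row and column blocks of sizes \<open>q, p - q, q\<close> grouped as
  \<open>(q, p - q)\<close> and \<open>q\<close>.  Both off-diagonal groups are written as a block matrix with an empty
  second block column (upper right) or an empty second block row (lower left).
\<close>

definition hyperbolic_mat :: "nat \<Rightarrow> nat \<Rightarrow> quat \<Rightarrow> real vec \<Rightarrow> quat mat" where
  "hyperbolic_mat p q \<eta> \<theta> =
    four_block_mat
      (four_block_mat (Ch_mat q \<theta>)        (0\<^sub>m q (p - q))
                      (0\<^sub>m (p - q) q)      (1\<^sub>m (p - q)))
      (four_block_mat (\<eta> \<cdot>\<^sub>m Sh_mat q \<theta>)  (0\<^sub>m q 0)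
                      (0\<^sub>m (p - q) q)      (0\<^sub>m (p - q) 0))
      (four_block_mat (- \<eta> \<cdot>\<^sub>m Sh_mat q \<theta>) (0\<^sub>m q (p - q))
                      (0\<^sub>m 0 q)            (0\<^sub>m 0 (p - q)))
      (Ch_mat q \<theta>)"

definition hyperbolic_factorization ::
  "nat \<Rightarrow> nat \<Rightarrow> quat \<Rightarrow> quat mat \<Rightarrow> complex mat \<Rightarrow> real vec \<Rightarrow> quat mat \<Rightarrow> quat mat \<Rightarrow> bool"
where
  "hyperbolic_factorization p q \<eta> M U \<theta> V\<^sub>p V\<^sub>q \<longleftrightarrow>
    complex_unitary (p + q) U \<and> \<theta> \<in> carrier_vec q \<and>
    quat_orthogonal p V\<^sub>p \<and> quat_orthogonal q V\<^sub>q \<and>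
    M = map_mat quat_of_complex U * hyperbolic_mat p q \<eta> \<theta>
          * four_block_mat V\<^sub>p (0\<^sub>m p q) (0\<^sub>m q p) V\<^sub>q"

definition eq_up_to_order_and_signs :: "nat \<Rightarrow> real vec \<Rightarrow> real vec \<Rightarrow> bool" where
  "eq_up_to_order_and_signs q \<theta> \<theta>' \<longleftrightarrow>
    (\<exists>\<pi> s. \<pi> permutes {..<q} \<and>
      (\<forall>a<q. s a \<in> {1, -1 :: real} \<and> \<theta>' $ a = s a * \<theta> $ \<pi> a))"

end

theory Submission
  imports Defs "HOL-Combinatorics.Permutations"
begin

text \<open>
  Let \<open>J = diag(I\<^sub>p, -I\<^sub>q)\<close> and let \<open>H(\<theta>)\<close> be the hyperbolic factor.  Everything is read off the
  involution \<open>S = M J M\<^sup>-\<^sup>1\<close>, which satisfies \<open>S\<^sup>2 = I\<close> and is self-adjoint for \<open>D\<^sub>i\<close>.  Writing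
  \<open>S = X + Y\<eta>\<close> with complex \<open>X\<close>, \<open>Y\<close>, this says that \<open>X\<close> is Hermitian, \<open>Y\<close> is symmetric,
  \<open>X\<^sup>2 = I + Y cnj(Y)\<close> and \<open>X Y = - Y cnj(X)\<close>.

  If \<open>M = U H(\<theta>) V\<close>, then \<open>V\<close> commutes with \<open>J\<close> and \<open>S = U H(2\<theta>) J U\<^sup>-\<^sup>1\<close>, so \<open>X\<close> has the eigenvalues
  \<open>cosh 2\<theta>\<^sub>a\<close>, 1 and \<open>- cosh 2\<theta>\<^sub>a\<close>; this determines every \<open>|\<theta>\<^sub>a|\<close>.

  Conversely, diagonalize \<open>X\<close>.  The antilinear map \<open>v \<mapsto> Y cnj(v)\<close> exchanges the eigenspaces for \<open>c\<close> and
  \<open>-c\<close> and scales norms by the square root of \<open>c\<^sup>2 - 1\<close>, so it pairs up the eigenvectors with \<open>|c| > 1\<close>; the real part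
  of the trace of \<open>S\<close> is \<open>p - q\<close>, so exactly \<open>p\<close> eigenvalues are positive.  In the resulting
  unitary basis \<open>S\<close> becomes \<open>H(2\<theta>) J = H(\<theta>) J H(-\<theta>)\<close>, and \<open>V = H(-\<theta>) U\<^sup>-\<^sup>1 M\<close> commutes with \<open>J\<close>.
\<close>

section \<open>Quaternions as pairs of complex numbers\<close>

lemmas quat_defs = zero_quat_def one_quat_def plus_quat_def uminus_quat_def minus_quat_def
  times_quat_def scaleR_quat_def quat_cnj_def quat_of_complex_def quat_i_def quat_j_def quat_k_def

lemma qRe_sum: "qRe (sum f A) = (\<Sum>a\<in>A. qRe (f a))"
  by (induction A rule: infinite_finite_induct) (simp_all add: quat_defs)

lemma quat_of_complex_simps [simp]:
  "quat_of_complex 0 = 0" "quat_of_complex 1 = 1"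
  "quat_of_complex (- z) = - quat_of_complex z"
  "quat_of_complex (z + w) = quat_of_complex z + quat_of_complex w"
  "quat_of_complex (z * w) = quat_of_complex z * quat_of_complex w"
  by (simp_all add: quat_defs)

lemma quat_of_complex_sum: "quat_of_complex (sum f A) = (\<Sum>a\<in>A. quat_of_complex (f a))"
  by (induction A rule: infinite_finite_induct) simp_all

lemma quat_of_complex_of_real [simp]: "quat_of_complex (of_real r) = of_real r"
  by (simp add: quat_defs of_real_def)

text \<open>The entrywise part of \<open>quat_adjoint_i\<close>: the anti-automorphism of order two
  that negates i and fixes 1, j and k.\<close>

definition quat_cnj_i :: "quat \<Rightarrow> quat" where
  "quat_cnj_i x = - quat_i * quat_cnj x * quat_i"

lemma quat_cnj_i_simps [simp]:
  "quat_cnj_i 0 = 0" "quat_cnj_i 1 = 1" "quat_cnj_i (- x) = - quat_cnj_i x"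
  "quat_cnj_i (x + y) = quat_cnj_i x + quat_cnj_i y"
  "quat_cnj_i (x * y) = quat_cnj_i y * quat_cnj_i x"
  "quat_cnj_i (quat_cnj_i x) = x"
  "quat_cnj_i (of_real r) = of_real r"
  "quat_cnj_i (quat_of_complex z) = quat_of_complex (cnj z)"
  by (simp_all add: quat_cnj_i_def quat_defs of_real_def algebra_simps)

lemma quat_cnj_i_sum: "quat_cnj_i (sum f A) = (\<Sum>a\<in>A. quat_cnj_i (f a))"
  by (induction A rule: infinite_finite_induct) simp_all

text \<open>Treats j and k at once: each squares to -1, passes a complex number at the price of
  conjugating it, and is fixed by \<open>quat_cnj_i\<close>.\<close>

locale perp_unit =
  fixes \<eta> :: quat
  assumes eta: "\<eta> \<in> {quat_j, quat_k}"
begin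

text \<open>Cayley-Dickson coordinates of a quaternion with respect to \<eta>.\<close>

definition pair :: "complex \<Rightarrow> complex \<Rightarrow> quat" where
  "pair z w = quat_of_complex z + quat_of_complex w * \<eta>"

lemma eta_square: "\<eta> * \<eta> = - 1"
  using eta by (auto simp: quat_defs)

lemma quat_cnj_i_eta [simp]: "quat_cnj_i \<eta> = \<eta>"
  using eta by (auto simp: quat_cnj_i_def quat_defs)

lemma eta_of_complex: "\<eta> * quat_of_complex z = quat_of_complex (cnj z) * \<eta>"
  using eta by (auto simp: quat_defs)

lemma eta_of_real: "\<eta> * of_real r = of_real r * \<eta>"
  using eta_of_complex [of "of_real r"] by simp

lemma pair_eq_iff [simp]: "pair z w = pair z' w' \<longleftrightarrow> z = z' \<and> w = w'"
  using eta by (auto simp: pair_def quat_defs complex_eq_iff)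

lemma pair_surj: "\<exists>z w. x = pair z w"
proof -
  from eta consider "\<eta> = quat_j" | "\<eta> = quat_k" by auto
  then show ?thesis
  proof cases
    case 1
    have "x = pair (Complex (qRe x) (qI x)) (Complex (qJ x) (qK x))"
      unfolding pair_def by (simp add: 1 quat_defs)
    then show ?thesis by blast
  next
    case 2
    \<comment> \<open>The minus sign comes from i k = -j.\<close>
    have "x = pair (Complex (qRe x) (qI x)) (Complex (qK x) (- qJ x))"
      unfolding pair_def by (simp add: 2 quat_defs)
    then show ?thesis by blast
  qed
qed

lemma pair_sum: "(\<Sum>a\<in>A. pair (f a) (g a)) = pair (sum f A) (sum g A)"
  by (simp add: pair_def sum.distrib quat_of_complex_sum sum_distrib_right)

lemma pair_mult: "pair z w * pair z' w' = pair (z * z' - w * cnj w') (z * w' + w * cnj z')"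
  using eta by (auto simp: pair_def quat_defs algebra_simps)

lemma pair_0 [simp]: "pair 0 0 = 0" and pair_1 [simp]: "pair 1 0 = 1"
  and pair_of_complex: "pair z 0 = quat_of_complex z"
  by (simp_all add: pair_def)

text \<open>The anti-automorphism sends w \<eta> to \<eta> cnj(w) = w \<eta>, so only the first
  coordinate is conjugated. This is why a self-adjoint matrix has a Hermitian first part and a
  symmetric second part.\<close>

lemma quat_cnj_i_pair: "quat_cnj_i (pair z w) = pair (cnj z) w"
  using eta by (auto simp: pair_def quat_cnj_i_def quat_defs)

lemma qRe_pair: "qRe (pair z w) = Re z"
  using eta by (auto simp: pair_def quat_defs)

end

section \<open>Quaternionic matrices\<close>

lemma mat_eqI:
  assumes "A \<in> carrier_mat n m" "B \<in> carrier_mat n m"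
    and "\<And>a b. a < n \<Longrightarrow> b < m \<Longrightarrow> A $$ (a, b) = B $$ (a, b)"
  shows "A = B"
  using assms by (intro eq_matI) auto

lemma mult_mat_entry:
  assumes "A \<in> carrier_mat n m" "B \<in> carrier_mat m k" "a < n" "b < k"
  shows "(A * B) $$ (a, b) = (\<Sum>c<m. A $$ (a, c) * B $$ (c, b))"
  using assms by (simp add: scalar_prod_def atLeast0LessThan)

lemma mult_square_carrier [simp]:
  "A \<in> carrier_mat n n \<Longrightarrow> B \<in> carrier_mat n n \<Longrightarrow> A * B \<in> carrier_mat n n"
  by (rule mult_carrier_mat)

lemma mult_square_one [simp]:
  fixes A :: "'a :: semiring_1 mat"
  assumes "A \<in> carrier_mat n n"
  shows "A * 1\<^sub>m n = A" "1\<^sub>m n * A = A"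
  using assms by auto

lemma mult_square_assoc:
  fixes A B C :: "'a :: semiring_0 mat"
  assumes "A \<in> carrier_mat n n" "B \<in> carrier_mat n n" "C \<in> carrier_mat n n"
  shows "A * B * C = A * (B * C)"
  using assms by (rule assoc_mult_mat)

lemma quat_adjoint_i_carrier [simp]:
  "M \<in> carrier_mat n m \<Longrightarrow> quat_adjoint_i M \<in> carrier_mat m n"
  by (simp add: quat_adjoint_i_def quat_adjoint_def)

lemma quat_adjoint_i_entry:
  assumes "M \<in> carrier_mat n m" "a < m" "b < n"
  shows "quat_adjoint_i M $$ (a, b) = quat_cnj_i (M $$ (b, a))"
  using assms by (simp add: quat_adjoint_i_def quat_adjoint_def quat_cnj_i_def)

lemma quat_adjoint_i_mult:
  assumes "A \<in> carrier_mat n m" "B \<in> carrier_mat m k"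
  shows "quat_adjoint_i (A * B) = quat_adjoint_i B * quat_adjoint_i A"
proof (rule mat_eqI)
  have AB: "A * B \<in> carrier_mat n k" using assms by simp
  then show "quat_adjoint_i (A * B) \<in> carrier_mat k n" by simp
  have c: "quat_adjoint_i B \<in> carrier_mat k m" "quat_adjoint_i A \<in> carrier_mat m n"
    using assms by simp_all
  then show "quat_adjoint_i B * quat_adjoint_i A \<in> carrier_mat k n" by simp
  fix a b assume ab: "a < k" "b < n"
  show "quat_adjoint_i (A * B) $$ (a, b) = (quat_adjoint_i B * quat_adjoint_i A) $$ (a, b)"
    using ab by (simp add: quat_adjoint_i_entry [OF AB] mult_mat_entry [OF assms] mult_mat_entry [OF c]
      quat_adjoint_i_entry [OF assms(1)] quat_adjoint_i_entry [OF assms(2)] quat_cnj_i_sum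
      del: index_mult_mat(1))
qed

lemma quat_adjoint_i_quat_adjoint_i [simp]: "quat_adjoint_i (quat_adjoint_i M) = M"
proof (rule mat_eqI)
  show M: "M \<in> carrier_mat (dim_row M) (dim_col M)" by simp
  then have M': "quat_adjoint_i M \<in> carrier_mat (dim_col M) (dim_row M)" by simp
  then show "quat_adjoint_i (quat_adjoint_i M) \<in> carrier_mat (dim_row M) (dim_col M)" by simp
  show "quat_adjoint_i (quat_adjoint_i M) $$ (a, b) = M $$ (a, b)"
    if "a < dim_row M" "b < dim_col M" for a b
    using that by (simp add: quat_adjoint_i_entry [OF M] quat_adjoint_i_entry [OF M'])
qed

lemma mat_adjoint_carrier [simp]: "A \<in> carrier_mat n m \<Longrightarrow> mat_adjoint A \<in> carrier_mat m n"
  unfolding mat_adjoint_def by (intro carrier_matI) (auto simp: mat_of_rows_def)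

lemma mat_adjoint_dim [simp]:
  "dim_row (mat_adjoint A) = dim_col A" "dim_col (mat_adjoint A) = dim_row A"
  unfolding mat_adjoint_def by (simp_all add: mat_of_rows_def)

lemma mat_adjoint_entry:
  fixes A :: "complex mat"
  assumes "A \<in> carrier_mat n m" "a < m" "b < n"
  shows "mat_adjoint A $$ (a, b) = cnj (A $$ (b, a))"
  using assms by (simp add: mat_adjoint_def mat_of_rows_def)

lemma mat_adjoint_mult:
  fixes A B :: "complex mat"
  assumes "A \<in> carrier_mat n m" "B \<in> carrier_mat m k"
  shows "mat_adjoint (A * B) = mat_adjoint B * mat_adjoint A"
proof (rule mat_eqI)
  have AB: "A * B \<in> carrier_mat n k" using assms by simp
  then show "mat_adjoint (A * B) \<in> carrier_mat k n" by simp
  have c: "mat_adjoint B \<in> carrier_mat k m" "mat_adjoint A \<in> carrier_mat m n"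
    using assms by simp_all
  then show "mat_adjoint B * mat_adjoint A \<in> carrier_mat k n" by simp
  fix a b assume ab: "a < k" "b < n"
  show "mat_adjoint (A * B) $$ (a, b) = (mat_adjoint B * mat_adjoint A) $$ (a, b)"
    using ab by (simp add: mat_adjoint_entry [OF AB] mult_mat_entry [OF assms] mult_mat_entry [OF c]
      mat_adjoint_entry [OF assms(1)] mat_adjoint_entry [OF assms(2)] mult.commute
      del: index_mult_mat(1))
qed

lemma quat_adjoint_i_of_complex:
  assumes "A \<in> carrier_mat n m"
  shows "quat_adjoint_i (map_mat quat_of_complex A) = map_mat quat_of_complex (mat_adjoint A)"
proof (rule mat_eqI)
  have A: "map_mat quat_of_complex A \<in> carrier_mat n m" using assms by simp
  then show "quat_adjoint_i (map_mat quat_of_complex A) \<in> carrier_mat m n" by simp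
  have A': "mat_adjoint A \<in> carrier_mat m n" using assms by simp
  then show "map_mat quat_of_complex (mat_adjoint A) \<in> carrier_mat m n" by simp
  fix a b assume ab: "a < m" "b < n"
  show "quat_adjoint_i (map_mat quat_of_complex A) $$ (a, b)
      = map_mat quat_of_complex (mat_adjoint A) $$ (a, b)"
    using ab assms carrier_matD [OF A']
    by (simp add: quat_adjoint_i_entry [OF A] mat_adjoint_entry [OF assms])
qed

lemma map_quat_of_complex_mult:
  assumes "A \<in> carrier_mat n m" "B \<in> carrier_mat m k"
  shows "map_mat quat_of_complex (A * B) = map_mat quat_of_complex A * map_mat quat_of_complex B"
  by (rule eq_matI) (use assms in \<open>auto simp: scalar_prod_def quat_of_complex_sum\<close>)

lemma map_quat_of_complex_one: "map_mat quat_of_complex (1\<^sub>m n) = 1\<^sub>m n"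
  by (rule eq_matI) auto

lemma map_cnj_mult:
  assumes "A \<in> carrier_mat n m" "B \<in> carrier_mat m k"
  shows "map_mat cnj (A * B) = map_mat cnj A * map_mat cnj B"
  by (rule eq_matI) (use assms in \<open>auto simp: scalar_prod_def\<close>)

lemma map_cnj_add: "map_mat cnj (A + B) = map_mat cnj A + map_mat cnj B"
  if "A \<in> carrier_mat n m" "B \<in> carrier_mat n m"
  using that by (intro eq_matI) auto

lemma map_cnj_diff: "map_mat cnj (A - B) = map_mat cnj A - map_mat cnj B"
  if "A \<in> carrier_mat n m" "B \<in> carrier_mat n m"
  using that by (intro eq_matI) auto

lemma map_cnj_zero [simp]: "map_mat cnj (0\<^sub>m n m) = 0\<^sub>m n m"
  by (intro eq_matI) auto

lemma map_cnj_cnj [simp]: "map_mat cnj (map_mat cnj A) = A"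
  by (intro eq_matI) auto

section \<open>Splitting quaternionic matrices into two complex ones\<close>

context perp_unit
begin

definition pair_mat :: "complex mat \<Rightarrow> complex mat \<Rightarrow> quat mat" where
  "pair_mat A B = mat (dim_row A) (dim_col A) (\<lambda>ab. pair (A $$ ab) (B $$ ab))"

lemma pair_mat_carrier [simp]: "A \<in> carrier_mat n m \<Longrightarrow> pair_mat A B \<in> carrier_mat n m"
  by (simp add: pair_mat_def)

lemma pair_mat_eq_iff:
  assumes "A \<in> carrier_mat n m" "B \<in> carrier_mat n m" "A' \<in> carrier_mat n m" "B' \<in> carrier_mat n m"
  shows "pair_mat A B = pair_mat A' B' \<longleftrightarrow> A = A' \<and> B = B'"
proof
  assume "pair_mat A B = pair_mat A' B'"
  then have "pair_mat A B $$ (a, b) = pair_mat A' B' $$ (a, b)" for a b by simp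
  from this have "A $$ (a, b) = A' $$ (a, b) \<and> B $$ (a, b) = B' $$ (a, b)" if "a < n" "b < m" for a b
    using assms that unfolding pair_mat_def by (metis (no_types, lifting) carrier_matD index_mat(1) pair_eq_iff)
  then show "A = A' \<and> B = B'"
    using assms by (auto intro!: eq_matI)
qed simp

lemma pair_mat_obtain:
  assumes "S \<in> carrier_mat n m"
  obtains A B where "A \<in> carrier_mat n m" "B \<in> carrier_mat n m" "S = pair_mat A B"
proof -
  from pair_surj obtain f g where fg: "\<And>x. x = pair (f x) (g x)" by metis
  have "S = pair_mat (map_mat f S) (map_mat g S)"
    by (rule eq_matI) (simp_all add: pair_mat_def fg [symmetric])
  with assms show ?thesis by (intro that) auto
qed

lemma pair_mat_mult:
  assumes "A \<in> carrier_mat n m" "B \<in> carrier_mat n m" "C \<in> carrier_mat m k" "D \<in> carrier_mat m k"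
  shows "pair_mat A B * pair_mat C D
    = pair_mat (A * C - B * map_mat cnj D) (A * D + B * map_mat cnj C)"
proof (rule mat_eqI)
  show "pair_mat A B * pair_mat C D \<in> carrier_mat n k"
    "pair_mat (A * C - B * map_mat cnj D) (A * D + B * map_mat cnj C) \<in> carrier_mat n k"
    using assms by (auto intro!: pair_mat_carrier mult_carrier_mat minus_carrier_mat)
  fix a b assume ab: "a < n" "b < k"
  have c: "map_mat cnj D \<in> carrier_mat m k" "map_mat cnj C \<in> carrier_mat m k"
    using assms by simp_all
  have "(pair_mat A B * pair_mat C D) $$ (a, b)
      = (\<Sum>c<m. pair (A $$ (a, c)) (B $$ (a, c)) * pair (C $$ (c, b)) (D $$ (c, b)))"
    unfolding mult_mat_entry [OF pair_mat_carrier [OF assms(1)] pair_mat_carrier [OF assms(3)] ab]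
    using assms ab by (intro sum.cong) (auto simp: pair_mat_def)
  also have "\<dots> = pair ((A * C) $$ (a, b) - (B * map_mat cnj D) $$ (a, b))
      ((A * D) $$ (a, b) + (B * map_mat cnj C) $$ (a, b))"
    unfolding mult_mat_entry [OF assms(1,3) ab] mult_mat_entry [OF assms(1,4) ab]
      mult_mat_entry [OF assms(2) c(1) ab] mult_mat_entry [OF assms(2) c(2) ab]
    using assms ab by (simp add: pair_mult pair_sum sum.distrib sum_subtractf)
  also have "\<dots> = pair_mat (A * C - B * map_mat cnj D) (A * D + B * map_mat cnj C) $$ (a, b)"
    using assms ab by (simp add: pair_mat_def)
  finally show "(pair_mat A B * pair_mat C D) $$ (a, b)
      = pair_mat (A * C - B * map_mat cnj D) (A * D + B * map_mat cnj C) $$ (a, b)" .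
qed

lemma pair_mat_one: "pair_mat (1\<^sub>m n) (0\<^sub>m n n) = 1\<^sub>m n"
  by (rule eq_matI) (auto simp: pair_mat_def)

lemma pair_mat_of_complex:
  "A \<in> carrier_mat n m \<Longrightarrow> pair_mat A (0\<^sub>m n m) = map_mat quat_of_complex A"
  by (rule eq_matI) (auto simp: pair_mat_def pair_of_complex)

lemma quat_adjoint_i_pair_mat:
  assumes "A \<in> carrier_mat n n" "B \<in> carrier_mat n n"
  shows "quat_adjoint_i (pair_mat A B) = pair_mat (mat_adjoint A) (transpose_mat B)"
proof (rule mat_eqI)
  have AB: "pair_mat A B \<in> carrier_mat n n" using assms by simp
  then show "quat_adjoint_i (pair_mat A B) \<in> carrier_mat n n" by simp
  have A': "mat_adjoint A \<in> carrier_mat n n" using assms by simp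
  then show "pair_mat (mat_adjoint A) (transpose_mat B) \<in> carrier_mat n n" by simp
  fix a b assume ab: "a < n" "b < n"
  show "quat_adjoint_i (pair_mat A B) $$ (a, b) = pair_mat (mat_adjoint A) (transpose_mat B) $$ (a, b)"
    unfolding quat_adjoint_i_entry [OF AB ab] using ab assms carrier_matD [OF A']
    by (simp add: pair_mat_def mat_adjoint_entry [OF assms(1)] quat_cnj_i_pair)
qed

text \<open>The quaternions \<open>z + w\<eta>\<close> embed into complex 2 by 2 matrices, so one-sided inverses of
  quaternionic square matrices are two-sided.\<close>

lemma quat_mat_left_right_inverse:
  fixes S T :: "quat mat"
  assumes S: "S \<in> carrier_mat n n" and T: "T \<in> carrier_mat n n" and ST: "S * T = 1\<^sub>m n"
  shows "T * S = 1\<^sub>m n"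
proof -
  obtain A B where A: "A \<in> carrier_mat n n" and B: "B \<in> carrier_mat n n" and S_eq: "S = pair_mat A B"
    using S by (rule pair_mat_obtain)
  obtain C D where C: "C \<in> carrier_mat n n" and D: "D \<in> carrier_mat n n" and T_eq: "T = pair_mat C D"
    using T by (rule pair_mat_obtain)
  define \<Phi> where "\<Phi> X Y = four_block_mat X Y (- map_mat cnj Y) (map_mat cnj X)" for X Y :: "complex mat"
  have \<Phi>_carrier: "\<Phi> X Y \<in> carrier_mat (n + n) (n + n)"
    if "X \<in> carrier_mat n n" "Y \<in> carrier_mat n n" for X Y
    using that by (simp add: \<Phi>_def)
  have \<Phi>_mult: "\<Phi> X Y * \<Phi> X' Y' = \<Phi> (X * X' - Y * map_mat cnj Y') (X * Y' + Y * map_mat cnj X')"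
    if "X \<in> carrier_mat n n" "Y \<in> carrier_mat n n" "X' \<in> carrier_mat n n" "Y' \<in> carrier_mat n n"
    for X Y X' Y'
  proof -
    have "\<Phi> X Y * \<Phi> X' Y' = four_block_mat (X * X' + Y * - map_mat cnj Y') (X * Y' + Y * map_mat cnj X')
      (- map_mat cnj Y * X' + map_mat cnj X * - map_mat cnj Y')
      (- map_mat cnj Y * Y' + map_mat cnj X * map_mat cnj X')"
      unfolding \<Phi>_def using that by (intro mult_four_block_mat) auto
    also have "\<dots> = \<Phi> (X * X' - Y * map_mat cnj Y') (X * Y' + Y * map_mat cnj X')"
      unfolding \<Phi>_def
    proof (rule cong_four_block_mat)
      have *: "X * X' \<in> carrier_mat n n" "Y * map_mat cnj Y' \<in> carrier_mat n n"
        "X * Y' \<in> carrier_mat n n" "Y * map_mat cnj X' \<in> carrier_mat n n"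
        "map_mat cnj Y * Y' \<in> carrier_mat n n" "map_mat cnj X * map_mat cnj X' \<in> carrier_mat n n"
        "map_mat cnj Y * X' \<in> carrier_mat n n" "map_mat cnj X * map_mat cnj Y' \<in> carrier_mat n n"
        using that by auto
      have m: "map_mat cnj (X * X') = map_mat cnj X * map_mat cnj X'"
        "map_mat cnj (X * Y') = map_mat cnj X * map_mat cnj Y'"
        "map_mat cnj (Y * map_mat cnj Y') = map_mat cnj Y * Y'"
        "map_mat cnj (Y * map_mat cnj X') = map_mat cnj Y * X'"
        using that by (simp_all add: map_cnj_mult [where n = n and m = n and k = n])
      show "X * X' + Y * - map_mat cnj Y' = X * X' - Y * map_mat cnj Y'"
        using that * by (intro eq_matI) (auto simp del: index_mult_mat(1))
      show "- map_mat cnj Y * X' + map_mat cnj X * - map_mat cnj Y'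
          = - map_mat cnj (X * Y' + Y * map_mat cnj X')"
        unfolding map_cnj_add [OF *(3,4)] m
        using that * by (intro eq_matI) (auto simp del: index_mult_mat(1))
      show "- map_mat cnj Y * Y' + map_mat cnj X * map_mat cnj X'
          = map_mat cnj (X * X' - Y * map_mat cnj Y')"
        unfolding map_cnj_diff [OF *(1,2)] m
        using that * by (intro eq_matI) (auto simp del: index_mult_mat(1))
    qed simp
    finally show ?thesis .
  qed
  have prod: "X * X' - Y * map_mat cnj Y' \<in> carrier_mat n n" "X * Y' + Y * map_mat cnj X' \<in> carrier_mat n n"
    if "X \<in> carrier_mat n n" "Y \<in> carrier_mat n n" "X' \<in> carrier_mat n n" "Y' \<in> carrier_mat n n"
    for X Y X' Y' :: "complex mat"
    using that by auto
  have one: "\<Phi> (1\<^sub>m n) (0\<^sub>m n n) = 1\<^sub>m (n + n)"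
    unfolding \<Phi>_def by (rule eq_matI) auto
  have "pair_mat (A * C - B * map_mat cnj D) (A * D + B * map_mat cnj C) = pair_mat (1\<^sub>m n) (0\<^sub>m n n)"
    using ST by (simp add: S_eq T_eq pair_mat_mult [OF A B C D] pair_mat_one)
  then have "A * C - B * map_mat cnj D = 1\<^sub>m n \<and> A * D + B * map_mat cnj C = 0\<^sub>m n n"
    using prod A B C D by (subst (asm) pair_mat_eq_iff) auto
  then have "\<Phi> A B * \<Phi> C D = 1\<^sub>m (n + n)"
    by (simp add: \<Phi>_mult [OF A B C D] one)
  then have *: "\<Phi> C D * \<Phi> A B = \<Phi> (1\<^sub>m n) (0\<^sub>m n n)"
    unfolding one by (rule mat_mult_left_right_inverse [OF \<Phi>_carrier [OF A B] \<Phi>_carrier [OF C D]])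
  define E F where "E = C * A - D * map_mat cnj B" and "F = C * B + D * map_mat cnj A"
  have EF: "E \<in> carrier_mat n n" "F \<in> carrier_mat n n"
    unfolding E_def F_def using prod A B C D by auto
  from * have \<Phi>_eq: "\<Phi> E F = \<Phi> (1\<^sub>m n) (0\<^sub>m n n)"
    by (simp add: \<Phi>_mult [OF C D A B] E_def F_def)
  \<comment> \<open>\<open>\<Phi> E F\<close> has upper block row E, F, so its value determines both
    matrices; the column offset \<open>n\<close> reads off F.\<close>
  have "E $$ (a, b) = 1\<^sub>m n $$ (a, b) \<and> F $$ (a, b) = 0" if "a < n" "b < n" for a b
  proof -
    have "\<Phi> E F $$ (a, b) = \<Phi> (1\<^sub>m n) (0\<^sub>m n n) $$ (a, b)"
      "\<Phi> E F $$ (a, n + b) = \<Phi> (1\<^sub>m n) (0\<^sub>m n n) $$ (a, n + b)" by (simp_all only: \<Phi>_eq)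
    with that EF show ?thesis by (simp add: \<Phi>_def)
  qed
  then have "E = 1\<^sub>m n" "F = 0\<^sub>m n n"
    using EF by (auto intro!: eq_matI)
  then show ?thesis
    by (simp add: S_eq T_eq pair_mat_mult [OF C D A B] pair_mat_one flip: E_def F_def)
qed

end

section \<open>The spectral theorem\<close>

lemma complex_unitaryD:
  assumes "complex_unitary n U"
  shows "U \<in> carrier_mat n n" "mat_adjoint U \<in> carrier_mat n n"
    "mat_adjoint U * U = 1\<^sub>m n" "U * mat_adjoint U = 1\<^sub>m n"
  using assms mat_mult_left_right_inverse [of "mat_adjoint U" n U]
  by (auto simp: complex_unitary_def)

lemma complex_unitary_mult:
  assumes "complex_unitary n U" "complex_unitary n W"
  shows "complex_unitary n (U * W)"
proof -
  note U = complex_unitaryD [OF assms(1)] and W = complex_unitaryD [OF assms(2)]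
  have "mat_adjoint (U * W) * (U * W) = mat_adjoint W * (mat_adjoint U * U) * W"
    using U(1,2) W(1,2) by (simp add: mat_adjoint_mult [OF U(1) W(1)] mult_square_assoc [where n = n])
  also have "\<dots> = 1\<^sub>m n" using U W by simp
  finally show ?thesis using U W by (simp add: complex_unitary_def)
qed

lemma mat_adjoint_mat_adjoint [simp]:
  fixes A :: "complex mat"
  shows "mat_adjoint (mat_adjoint A) = A"
proof (rule mat_eqI)
  show A: "A \<in> carrier_mat (dim_row A) (dim_col A)" by simp
  then have A': "mat_adjoint A \<in> carrier_mat (dim_col A) (dim_row A)" by simp
  then show "mat_adjoint (mat_adjoint A) \<in> carrier_mat (dim_row A) (dim_col A)" by simp
  show "mat_adjoint (mat_adjoint A) $$ (a, b) = A $$ (a, b)" if "a < dim_row A" "b < dim_col A" for a b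
    using that by (simp add: mat_adjoint_entry [OF A] mat_adjoint_entry [OF A'])
qed

text \<open>Complete v to a basis and apply Gram-Schmidt, which keeps the first vector; dividing
  each vector by its norm \<open>\<nu> b\<close> then gives the columns. The scalar c is the inverse
  of the norm of v.\<close>

lemma unitary_with_first_column:
  fixes v :: "complex vec"
  assumes v: "v \<in> carrier_vec n" and v0: "v \<noteq> 0\<^sub>v n"
  obtains U c where "complex_unitary n U" "\<And>a. a < n \<Longrightarrow> U $$ (a, 0) = c * v $ a"
proof -
  interpret cof_vec_space n "TYPE(complex)" .
  define ws where "ws = gram_schmidt n (basis_completion v)"
  have n: "0 < n" using v v0 by (cases n) auto
  note bc = basis_completion [OF v v0]
  have ws: "set ws \<subseteq> carrier_vec n" "corthogonal ws" "length ws = n"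
    using gram_schmidt_result [OF bc(2) bc(4) bc(5) refl, folded ws_def] bc(6) by auto
  have hd: "ws ! 0 = v"
  proof -
    obtain vs where "basis_completion v = v # vs"
      using bc(6,7) n by (cases "basis_completion v") auto
    then have "hd ws = v" unfolding ws_def using gram_schmidt_hd [OF v] by simp
    then show ?thesis using ws(3) n by (simp add: hd_conv_nth flip: length_greater_0_conv)
  qed
  have wsc: "ws ! b \<in> carrier_vec n" if "b < n" for b
    using ws that by auto
  have inner: "ws ! b \<bullet>c ws ! a = (\<Sum>c<n. cnj (ws ! a $ c) * ws ! b $ c)" if "a < n" "b < n" for a b
    using wsc that by (auto simp: scalar_prod_def atLeast0LessThan mult.commute intro!: sum.cong)
  define \<nu> where "\<nu> b = sqrt (\<Sum>c<n. (cmod (ws ! b $ c))\<^sup>2)" for b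
  have \<nu>2: "complex_of_real (\<nu> b) * of_real (\<nu> b) = ws ! b \<bullet>c ws ! b" if "b < n" for b
  proof -
    have "\<nu> b * \<nu> b = (\<Sum>c<n. (cmod (ws ! b $ c))\<^sup>2)"
      by (simp add: \<nu>_def sum_nonneg)
    then have "complex_of_real (\<nu> b) * of_real (\<nu> b) = of_real (\<Sum>c<n. (cmod (ws ! b $ c))\<^sup>2)"
      by (simp flip: of_real_mult)
    also have "\<dots> = ws ! b \<bullet>c ws ! b"
      unfolding inner [OF that that] of_real_sum
      by (intro sum.cong) (simp_all add: mult.commute flip: complex_norm_square)
    finally show ?thesis .
  qed
  have \<nu>0: "complex_of_real (\<nu> b) \<noteq> 0" if "b < n" for b
    using \<nu>2 [OF that] corthogonalD [OF ws(2), of b b] ws(3) that by auto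
  define U where "U = mat n n (\<lambda>(a, b). ws ! b $ a / of_real (\<nu> b))"
  have U: "U \<in> carrier_mat n n" by (simp add: U_def)
  have U_entry: "U $$ (a, b) = ws ! b $ a / of_real (\<nu> b)" if "a < n" "b < n" for a b
    using that by (simp add: U_def)
  have "mat_adjoint U * U = 1\<^sub>m n"
  proof (rule mat_eqI)
    show "mat_adjoint U * U \<in> carrier_mat n n" using U mat_adjoint_carrier [OF U] by simp
    fix a b assume ab: "a < n" "b < n"
    have "(mat_adjoint U * U) $$ (a, b) = (\<Sum>c<n. cnj (ws ! a $ c) * ws ! b $ c / (of_real (\<nu> a) * of_real (\<nu> b)))"
      unfolding mult_mat_entry [OF mat_adjoint_carrier [OF U] U ab]
      by (intro sum.cong) (use ab in \<open>simp_all add: mat_adjoint_entry [OF U] U_entry\<close>)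
    also have "\<dots> = (ws ! b \<bullet>c ws ! a) / (of_real (\<nu> a) * of_real (\<nu> b))"
      by (simp only: inner [OF ab] sum_divide_distrib)
    also have "\<dots> = 1\<^sub>m n $$ (a, b)"
    proof (cases "a = b")
      case True
      then show ?thesis using ab \<nu>0 [OF ab(1)] by (simp flip: \<nu>2)
    next
      case False
      then show ?thesis using ab corthogonalD [OF ws(2), of b a] ws(3) by simp
    qed
    finally show "(mat_adjoint U * U) $$ (a, b) = 1\<^sub>m n $$ (a, b)" .
  qed simp
  then have "complex_unitary n U" using U by (simp add: complex_unitary_def)
  moreover have "U $$ (a, 0) = 1 / of_real (\<nu> 0) * v $ a" if "a < n" for a
    using that n hd by (simp add: U_entry)
  ultimately show ?thesis by (rule that)
qed

lemma mat_adjoint_four_block_diag: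
  fixes A D :: "complex mat"
  assumes A: "A \<in> carrier_mat n n" and D: "D \<in> carrier_mat m m"
  shows "mat_adjoint (four_block_mat A (0\<^sub>m n m) (0\<^sub>m m n) D)
    = four_block_mat (mat_adjoint A) (0\<^sub>m n m) (0\<^sub>m m n) (mat_adjoint D)"
proof (rule mat_eqI)
  have c: "four_block_mat A (0\<^sub>m n m) (0\<^sub>m m n) D \<in> carrier_mat (n + m) (n + m)"
    using A D by simp
  then show "mat_adjoint (four_block_mat A (0\<^sub>m n m) (0\<^sub>m m n) D) \<in> carrier_mat (n + m) (n + m)"
    by simp
  note A' = mat_adjoint_carrier [OF A] and D' = mat_adjoint_carrier [OF D]
  then show "four_block_mat (mat_adjoint A) (0\<^sub>m n m) (0\<^sub>m m n) (mat_adjoint D) \<in> carrier_mat (n + m) (n + m)"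
    by simp
  fix a b assume "a < n + m" "b < n + m"
  then show "mat_adjoint (four_block_mat A (0\<^sub>m n m) (0\<^sub>m m n) D) $$ (a, b)
    = four_block_mat (mat_adjoint A) (0\<^sub>m n m) (0\<^sub>m m n) (mat_adjoint D) $$ (a, b)"
    using A D carrier_matD [OF A'] carrier_matD [OF D']
    by (simp add: mat_adjoint_entry [OF c] mat_adjoint_entry [OF A] mat_adjoint_entry [OF D])
qed

text \<open>Induction on the eigenvalues. Conjugation by a unitary matrix whose first column is an
  eigenvector clears the first column below the corner; Hermitian symmetry clears the first row as
  well, and a smaller Hermitian block remains. Since any listing of the roots may be supplied, the
  order on the diagonal can be prescribed.\<close>

lemma hermitian_diagonalize_list:
  fixes A :: "complex mat"
  assumes "A \<in> carrier_mat n n" "mat_adjoint A = A" "char_poly A = (\<Prod>e\<leftarrow>es. [:- e, 1:])"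
  shows "\<exists>U. complex_unitary n U \<and> mat_adjoint U * A * U = mat_diag n (\<lambda>a. es ! a)"
  using assms
proof (induction es arbitrary: n A)
  case Nil
  then have "n = 0" using degree_monic_char_poly [of A n] by simp
  with Nil show ?case
    by (intro exI [of _ "1\<^sub>m 0"]) (auto simp: complex_unitary_def intro!: mat_eqI [of _ 0 0] mult_carrier_mat)
next
  case (Cons e es)
  note A = \<open>A \<in> carrier_mat n n\<close>
  have ev: "eigenvalue A e"
    unfolding eigenvalue_root_char_poly [OF A] Cons.prems by simp
  then obtain v where v: "v \<in> carrier_vec n" "v \<noteq> 0\<^sub>v n" "A *\<^sub>v v = e \<cdot>\<^sub>v v"
    using A unfolding eigenvalue_def eigenvector_def by auto
  obtain m where n: "n = Suc m" using v by (cases n) auto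
  then have n0: "0 < n" by simp
  obtain W c where Wu: "complex_unitary n W" and Wc: "\<And>a. a < n \<Longrightarrow> W $$ (a, 0) = c * v $ a"
    using unitary_with_first_column [OF v(1,2)] by blast
  note W = complex_unitaryD [OF Wu]
  define A' where "A' = mat_adjoint W * A * W"
  have A': "A' \<in> carrier_mat n n" using W A by (simp add: A'_def)
  have A'h: "mat_adjoint A' = A'"
    using W(1,2) A Cons.prems(2)
    by (simp add: A'_def mat_adjoint_mult [where n = n and m = n and k = n] mult_square_assoc [where n = n])
  have AW0: "(A * W) $$ (a, 0) = e * W $$ (a, 0)" if "a < n" for a
  proof -
    have "(A * W) $$ (a, 0) = (\<Sum>k<n. A $$ (a, k) * v $ k) * c"
      using mult_mat_entry [OF A W(1) that, of 0] n0 Wc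
      by (simp add: sum_distrib_left mult.assoc mult.commute mult.left_commute del: index_mult_mat(1))
    also have "(\<Sum>k<n. A $$ (a, k) * v $ k) = (A *\<^sub>v v) $ a"
      using A v(1) that by (auto simp: scalar_prod_def atLeast0LessThan)
    finally show ?thesis using v that by (simp add: Wc)
  qed
  \<comment> \<open>The first column of \<open>A * W\<close> is e times that of W, and the adjoint
    of W turns the latter into the first unit vector.\<close>
  have col0: "A' $$ (a, 0) = (if a = 0 then e else 0)" if "a < n" for a
  proof -
    have "A' $$ (a, 0) = (mat_adjoint W * (A * W)) $$ (a, 0)"
      using W A by (simp add: A'_def mult_square_assoc [where n = n])
    also have "\<dots> = e * (mat_adjoint W * W) $$ (a, 0)"
      using that n0 W A mult_mat_entry [OF W(2) mult_carrier_mat [OF A W(1)] that, of 0]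
        mult_mat_entry [OF W(2) W(1) that, of 0]
      by (simp add: AW0 sum_distrib_left mult.left_commute del: index_mult_mat(1))
    finally show ?thesis using W that n0 by simp
  qed
  have row0: "A' $$ (0, b) = 0" if "0 < b" "b < n" for b
    using mat_adjoint_entry [OF A', of 0 b] col0 [of b] that n A'h by simp
  define A3 where "A3 = mat m m (\<lambda>(a, b). A' $$ (Suc a, Suc b))"
  have A3: "A3 \<in> carrier_mat m m" by (simp add: A3_def)
  define E where "E = mat 1 1 (\<lambda>_. e)"
  have E: "E \<in> carrier_mat 1 1" by (simp add: E_def)
  have block: "A' = four_block_mat E (0\<^sub>m 1 m) (0\<^sub>m m 1) A3"
    by (rule mat_eqI [OF A']) (use col0 row0 n in \<open>auto simp: E_def A3_def\<close>)
  have A3h: "mat_adjoint A3 = A3"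
  proof (rule mat_eqI [OF mat_adjoint_carrier [OF A3] A3])
    fix a b assume "a < m" "b < m"
    then show "mat_adjoint A3 $$ (a, b) = A3 $$ (a, b)"
      using mat_adjoint_entry [OF A', of "Suc a" "Suc b"] n
      by (simp add: mat_adjoint_entry [OF A3]) (simp add: A3_def A'h)
  qed
  \<comment> \<open>The characteristic polynomial is kept by the similarity and factors along the
    blocks; cancelling the factor of e shows that the smaller block has the roots
    \<open>es\<close>.\<close>
  have "similar_mat A' A"
    unfolding similar_mat_def
    using similar_mat_witI [OF W(3,4) A'_def A' A W(2,1)] by blast
  then have "char_poly A' = char_poly A" by (rule char_poly_similar)
  moreover have "char_poly A' = char_poly E * char_poly A3"
    unfolding block by (rule char_poly_four_block_zeros_col [OF E _ A3]) simp
  moreover have "char_poly E = [:- e, 1:]"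
    by (simp add: E_def char_poly_defs det_def sign_def)
  ultimately have "[:- e, 1:] * char_poly A3 = [:- e, 1:] * (\<Prod>e\<leftarrow>es. [:- e, 1:])"
    by (simp only: Cons.prems(3) list.map prod_list.Cons)
  then have "char_poly A3 = (\<Prod>e\<leftarrow>es. [:- e, 1:])"
    by (metis mult_cancel_left pCons_eq_0_iff zero_neq_one)
  from Cons.IH [OF A3 A3h this] obtain U where Uu: "complex_unitary m U"
    and UA: "mat_adjoint U * A3 * U = mat_diag m (\<lambda>a. es ! a)" by blast
  note U = complex_unitaryD [OF Uu]
  define F where "F = four_block_mat (1\<^sub>m 1) (0\<^sub>m 1 m) (0\<^sub>m m 1) U"
  have F: "F \<in> carrier_mat n n" unfolding F_def n
    using four_block_carrier_mat [OF one_carrier_mat [of 1] U(1)] by simp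
  have one: "mat_adjoint (1\<^sub>m 1) = (1\<^sub>m 1 :: complex mat)"
    by (rule mat_eqI [of _ 1 1]) (simp_all add: mat_adjoint_entry [of _ 1 1])
  have F_adj: "mat_adjoint F = four_block_mat (1\<^sub>m 1) (0\<^sub>m 1 m) (0\<^sub>m m 1) (mat_adjoint U)"
    unfolding F_def mat_adjoint_four_block_diag [OF one_carrier_mat U(1)] one ..
  have mult: "four_block_mat X (0\<^sub>m 1 m) (0\<^sub>m m 1) Y * four_block_mat X' (0\<^sub>m 1 m) (0\<^sub>m m 1) Y'
      = four_block_mat (X * X') (0\<^sub>m 1 m) (0\<^sub>m m 1) (Y * Y')"
    if "X \<in> carrier_mat 1 1" "X' \<in> carrier_mat 1 1" "Y \<in> carrier_mat m m" "Y' \<in> carrier_mat m m"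
    for X X' Y Y' :: "complex mat"
    using that by (subst mult_four_block_mat [of _ 1 1 _ m _ m _ _ 1 _ m]) auto
  have "mat_adjoint F * F = four_block_mat (1\<^sub>m 1) (0\<^sub>m 1 m) (0\<^sub>m m 1) (1\<^sub>m m)"
    unfolding F_adj unfolding F_def using U by (simp add: mult del: four_block_one_mat One_nat_def)
  also have "\<dots> = 1\<^sub>m n" by (simp add: n)
  finally have Fu: "complex_unitary n F" using F by (simp add: complex_unitary_def)
  have "mat_adjoint (W * F) * A * (W * F) = mat_adjoint F * A' * F"
    using W(1,2) A F mat_adjoint_carrier [OF F]
    by (simp add: A'_def mat_adjoint_mult [where n = n and m = n and k = n] mult_square_assoc [where n = n])
  also have "\<dots> = four_block_mat E (0\<^sub>m 1 m) (0\<^sub>m m 1) (mat_diag m (\<lambda>a. es ! a))"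
    unfolding F_adj block unfolding F_def using U A3 E by (simp add: mult UA del: One_nat_def)
  also have "\<dots> = mat_diag n (\<lambda>a. (e # es) ! a)"
    by (rule mat_eqI [of _ n n]) (auto simp: n E_def mat_diag_def)
  finally show ?case using complex_unitary_mult [OF Wu Fu] by blast
qed

text \<open>Diagonalizes twice. The first pass serves to show that the eigenvalues are real, as
  diagonal entries of a Hermitian matrix; they can then be sorted in decreasing order, and the
  second pass uses the sorted list.\<close>

lemma hermitian_diagonalize:
  fixes A :: "complex mat"
  assumes A: "A \<in> carrier_mat n n" and herm: "mat_adjoint A = A"
  obtains U and d :: "nat \<Rightarrow> real" where "complex_unitary n U"
    "mat_adjoint U * A * U = mat_diag n (\<lambda>a. of_real (d a))"
    "\<And>a b. a \<le> b \<Longrightarrow> b < n \<Longrightarrow> d b \<le> d a"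
proof -
  obtain es where es: "char_poly A = (\<Prod>e\<leftarrow>es. [:- e, 1:])" "length es = n"
    using char_poly_factorized [OF A] by blast
  have herm': "mat_adjoint (mat_adjoint U * A * U) = mat_adjoint U * A * U"
    if "complex_unitary n U" for U
    using complex_unitaryD(1,2) [OF that] A herm
    by (simp add: mat_adjoint_mult [where n = n and m = n and k = n] mult_square_assoc [where n = n])
  obtain U where Uu: "complex_unitary n U"
    and UA: "mat_adjoint U * A * U = mat_diag n (\<lambda>a. es ! a)"
    using hermitian_diagonalize_list [OF A herm es(1)] by blast
  have real: "es ! a = of_real (Re (es ! a))" if "a < n" for a
  proof -
    have D: "mat_diag n (\<lambda>a. es ! a) \<in> carrier_mat n n" by simp
    from herm' [OF Uu] mat_adjoint_entry [OF D that that] that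
    have "cnj (es ! a) = es ! a" by (simp add: UA mat_diag_def)
    then show ?thesis by (simp add: complex_eq_iff)
  qed
  define rs where "rs = rev (sort (map Re es))"
  have es_real: "map of_real (map Re es) = es"
    by (rule nth_equalityI) (simp_all add: es(2) flip: real)
  have "mset (map complex_of_real rs) = mset (map of_real (map Re es))"
    unfolding rs_def mset_map mset_rev mset_sort ..
  then have "mset (map complex_of_real rs) = mset es" unfolding es_real .
  then have "mset (map (\<lambda>e. [:- e, 1:]) (map complex_of_real rs)) = mset (map (\<lambda>e. [:- e, 1:]) es)"
    unfolding mset_map [of "\<lambda>e. [:- e, 1:]"] by (rule arg_cong)
  then have "char_poly A = (\<Prod>e\<leftarrow>map of_real rs. [:- e, 1:])"
    unfolding es(1) prod_mset_prod_list [symmetric] by (rule arg_cong [OF sym])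
  from hermitian_diagonalize_list [OF A herm this] obtain V where V: "complex_unitary n V"
    "mat_adjoint V * A * V = mat_diag n (\<lambda>a. map complex_of_real rs ! a)" by blast
  have len: "length rs = n" by (simp add: rs_def es(2))
  have "mat_diag n (\<lambda>a. map complex_of_real rs ! a) = mat_diag n (\<lambda>a. of_real (rs ! a))"
    by (rule mat_eqI [of _ n n]) (auto simp: mat_diag_def len)
  moreover have "rs ! b \<le> rs ! a" if "a \<le> b" "b < n" for a b
  proof -
    have "sorted (rev rs)" by (simp add: rs_def)
    then show ?thesis using that len by (intro sorted_rev_nth_mono) auto
  qed
  ultimately show ?thesis using V by (intro that [of V "\<lambda>a. rs ! a"]) auto
qed

section \<open>The hyperbolic factor\<close>

text \<open>The matrix \<open>diag f + diag g \<cdot> \<Pi>\<close>, where \<open>\<Pi>\<close> is the permutation matrix of \<open>\<sigma>\<close>.\<close>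

definition cross_mat :: "nat \<Rightarrow> (nat \<Rightarrow> nat) \<Rightarrow> (nat \<Rightarrow> 'a) \<Rightarrow> (nat \<Rightarrow> 'a) \<Rightarrow> 'a :: ring_1 mat" where
  "cross_mat n \<sigma> f g = mat n n (\<lambda>(a, b). (if b = a then f a else 0) + (if b = \<sigma> a then g a else 0))"

lemma cross_mat_carrier [simp]: "cross_mat n \<sigma> f g \<in> carrier_mat n n"
  by (simp add: cross_mat_def)

lemma cross_mat_entry:
  "a < n \<Longrightarrow> b < n \<Longrightarrow>
    cross_mat n \<sigma> f g $$ (a, b) = (if b = a then f a else 0) + (if b = \<sigma> a then g a else 0)"
  by (simp add: cross_mat_def)

lemma cross_mat_cong:
  assumes "\<And>a. a < n \<Longrightarrow> f a = f' a" "\<And>a. a < n \<Longrightarrow> g a = g' a"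
  shows "cross_mat n \<sigma> f g = cross_mat n \<sigma> f' g'"
  using assms by (intro mat_eqI [of _ n n]) (auto simp: cross_mat_entry)

text \<open>The permutation matrix of the involution \<sigma> squares to the identity, and moving a
  diagonal matrix past it reindexes the entries by \<sigma>.\<close>

lemma cross_mat_mult:
  assumes \<sigma>: "\<And>a. a < n \<Longrightarrow> \<sigma> a < n" "\<And>a. a < n \<Longrightarrow> \<sigma> (\<sigma> a) = a"
  shows "cross_mat n \<sigma> f g * cross_mat n \<sigma> f' g'
    = cross_mat n \<sigma> (\<lambda>a. f a * f' a + g a * g' (\<sigma> a)) (\<lambda>a. f a * g' a + g a * f' (\<sigma> a))"
proof (rule mat_eqI [of _ n n])
  fix a b assume ab: "a < n" "b < n"
  define h where "h c = (if b = c then f' c else 0) + (if b = \<sigma> c then g' c else 0)" for c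
  have "(cross_mat n \<sigma> f g * cross_mat n \<sigma> f' g') $$ (a, b)
      = (\<Sum>c<n. ((if c = a then f a else 0) + (if c = \<sigma> a then g a else 0)) * h c)"
    unfolding mult_mat_entry [OF cross_mat_carrier cross_mat_carrier ab]
    using ab by (intro sum.cong) (auto simp: cross_mat_entry h_def)
  also have "\<dots> = (\<Sum>c<n. (if c = a then f a * h a else 0) + (if c = \<sigma> a then g a * h (\<sigma> a) else 0))"
    by (intro sum.cong) (auto simp: distrib_right)
  also have "\<dots> = f a * h a + g a * h (\<sigma> a)"
    using ab \<sigma>(1) by (simp add: sum.distrib)
  also have "\<dots> = cross_mat n \<sigma> (\<lambda>a. f a * f' a + g a * g' (\<sigma> a))
      (\<lambda>a. f a * g' a + g a * f' (\<sigma> a)) $$ (a, b)"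
    using ab \<sigma>(2) by (auto simp: cross_mat_entry h_def distrib_left)
  finally show "(cross_mat n \<sigma> f g * cross_mat n \<sigma> f' g') $$ (a, b)
    = cross_mat n \<sigma> (\<lambda>a. f a * f' a + g a * g' (\<sigma> a)) (\<lambda>a. f a * g' a + g a * f' (\<sigma> a)) $$ (a, b)" .
qed simp_all

text \<open>Pairs the two outer blocks of size q and fixes the middle one. At a fixed index
  \<open>cross_mat\<close> adds both coefficients in one entry, so the second must vanish
  there.\<close>

definition swap_outer :: "nat \<Rightarrow> nat \<Rightarrow> nat \<Rightarrow> nat" where
  "swap_outer p q a = (if a < q then p + a else if a < p then a else a - p)"

text \<open>Paired indices share an angle. The value 0 on the middle block makes cosh and sinh
  produce the entries 1 and 0 of the identity block.\<close>

definition angle :: "nat \<Rightarrow> nat \<Rightarrow> (nat \<Rightarrow> real) \<Rightarrow> nat \<Rightarrow> real" where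
  "angle p q t a = (if a < q then t a else if a < p then 0 else t (a - p))"

definition block_sign :: "nat \<Rightarrow> nat \<Rightarrow> real" where
  "block_sign p a = (if a < p then 1 else - 1)"

definition signature_mat :: "nat \<Rightarrow> nat \<Rightarrow> quat mat" where
  "signature_mat p q = mat_diag (p + q) (\<lambda>a. of_real (block_sign p a))"

lemma swap_outer_less: "q \<le> p \<Longrightarrow> a < p + q \<Longrightarrow> swap_outer p q a < p + q"
  by (auto simp: swap_outer_def)

lemma swap_outer_swap_outer: "q \<le> p \<Longrightarrow> a < p + q \<Longrightarrow> swap_outer p q (swap_outer p q a) = a"
  by (auto simp: swap_outer_def)

lemma angle_swap_outer: "q \<le> p \<Longrightarrow> a < p + q \<Longrightarrow> angle p q t (swap_outer p q a) = angle p q t a"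
  by (auto simp: swap_outer_def angle_def)

text \<open>The swap reverses the sign of an outer index; on the middle block sinh is 0.\<close>

lemma block_sign_sinh_swap_outer:
  "q \<le> p \<Longrightarrow> a < p + q \<Longrightarrow>
    block_sign p (swap_outer p q a) * sinh (angle p q t a) = - (block_sign p a * sinh (angle p q t a))"
  by (auto simp: swap_outer_def angle_def block_sign_def)

lemma signature_mat_carrier [simp]: "signature_mat p q \<in> carrier_mat (p + q) (p + q)"
  by (simp add: signature_mat_def)

lemma signature_mat_square: "signature_mat p q * signature_mat p q = 1\<^sub>m (p + q)"
  unfolding signature_mat_def mat_diag_diag
  by (intro mat_eqI [of _ "p + q" "p + q"]) (auto simp: mat_diag_def block_sign_def)

lemma quat_adjoint_i_signature_mat: "quat_adjoint_i (signature_mat p q) = signature_mat p q"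
proof (rule mat_eqI [of _ "p + q" "p + q"])
  show "quat_adjoint_i (signature_mat p q) $$ (a, b) = signature_mat p q $$ (a, b)"
    if "a < p + q" "b < p + q" for a b
    using that by (simp add: quat_adjoint_i_entry [OF signature_mat_carrier])
      (simp add: signature_mat_def mat_diag_def)
qed simp_all

section \<open>Addition law, adjoint and signature of the hyperbolic matrices\<close>

context perp_unit
begin

text \<open>The factor \<open>hyperbolic_mat\<close> in the form of a \<open>cross_mat\<close>, so
  that matrix products become pointwise identities between cosh and sinh.\<close>

definition hyp :: "nat \<Rightarrow> nat \<Rightarrow> (nat \<Rightarrow> real) \<Rightarrow> quat mat" where
  "hyp p q t = cross_mat (p + q) (swap_outer p q)
    (\<lambda>a. of_real (cosh (angle p q t a))) (\<lambda>a. of_real (block_sign p a * sinh (angle p q t a)) * \<eta>)"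

lemma hyp_carrier [simp]: "hyp p q t \<in> carrier_mat (p + q) (p + q)"
  by (simp add: hyp_def)

lemma hyperbolic_mat_eq_hyp:
  assumes "q \<le> p"
  shows "hyperbolic_mat p q \<eta> \<theta> = hyp p q (\<lambda>a. \<theta> $ a)"
proof (rule mat_eqI [of _ "p + q" "p + q"])
  show "hyperbolic_mat p q \<eta> \<theta> \<in> carrier_mat (p + q) (p + q)"
    using assms unfolding hyperbolic_mat_def Ch_mat_def Sh_mat_def
    by (intro four_block_carrier_mat carrier_matI) (simp_all add: mat_diag_def)
  fix a b assume "a < p + q" "b < p + q"
  then show "hyperbolic_mat p q \<eta> \<theta> $$ (a, b) = hyp p q (\<lambda>a. \<theta> $ a) $$ (a, b)"
    using assms
    by (auto simp: hyperbolic_mat_def Ch_mat_def Sh_mat_def mat_diag_def hyp_def cross_mat_entry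
        swap_outer_def angle_def block_sign_def eta_of_real)
qed simp

text \<open>These are the addition formulas. In the diagonal coefficient the opposite block signs of
  paired indices cancel against \<eta>^2 = -1, so the product of the two sinh enters with a plus
  sign.\<close>

lemma hyp_mult:
  assumes "q \<le> p"
  shows "hyp p q t * hyp p q u = hyp p q (\<lambda>a. t a + u a)"
proof -
  have eta_combine: "of_real x * (of_real y * \<eta>) + of_real z * \<eta> * of_real w
      = of_real (x * y + z * w) * \<eta>" for x y z w
    by (simp add: mult.assoc eta_of_real distrib_right)
  let ?c = "\<lambda>t a. of_real (cosh (angle p q t a)) :: quat"
  let ?s = "\<lambda>t a. of_real (block_sign p a * sinh (angle p q t a)) * \<eta>"
  have "hyp p q t * hyp p q u = cross_mat (p + q) (swap_outer p q)
      (\<lambda>a. ?c t a * ?c u a + ?s t a * ?s u (swap_outer p q a))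
      (\<lambda>a. ?c t a * ?s u a + ?s t a * ?c u (swap_outer p q a))"
    unfolding hyp_def by (rule cross_mat_mult) (simp_all add: swap_outer_less swap_outer_swap_outer assms)
  also have "\<dots> = hyp p q (\<lambda>a. t a + u a)"
    unfolding hyp_def
  proof (rule cross_mat_cong)
  fix a assume a: "a < p + q"
  have add: "angle p q (\<lambda>a. t a + u a) a = angle p q t a + angle p q u a"
    by (simp add: angle_def)
  have "of_real (block_sign p a * sinh (angle p q t a)) * \<eta>
      * (of_real (block_sign p (swap_outer p q a) * sinh (angle p q u (swap_outer p q a))) * \<eta>)
      = - of_real (block_sign p a * sinh (angle p q t a) * (block_sign p (swap_outer p q a) * sinh (angle p q u a)))"
    using angle_swap_outer [OF assms a]
    by (simp add: mult.assoc eta_square eta_of_real flip: mult.assoc [of \<eta>])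
  also have "block_sign p a * sinh (angle p q t a) * (block_sign p (swap_outer p q a) * sinh (angle p q u a))
      = - (sinh (angle p q t a) * sinh (angle p q u a))"
    unfolding block_sign_sinh_swap_outer [OF assms a] by (simp add: block_sign_def)
  finally show "of_real (cosh (angle p q t a)) * of_real (cosh (angle p q u a)) +
      of_real (block_sign p a * sinh (angle p q t a)) * \<eta>
      * (of_real (block_sign p (swap_outer p q a) * sinh (angle p q u (swap_outer p q a))) * \<eta>)
    = of_real (cosh (angle p q (\<lambda>a. t a + u a) a))"
    by (simp add: add cosh_add)
  show "of_real (cosh (angle p q t a)) * (of_real (block_sign p a * sinh (angle p q u a)) * \<eta>) +
      of_real (block_sign p a * sinh (angle p q t a)) * \<eta> * of_real (cosh (angle p q u (swap_outer p q a)))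
    = of_real (block_sign p a * sinh (angle p q (\<lambda>a. t a + u a) a)) * \<eta>"
    unfolding angle_swap_outer [OF assms a] add sinh_add eta_combine
    by (simp only: distrib_left ac_simps)
  qed
  finally show ?thesis .
qed

lemma hyp_zero: "hyp p q (\<lambda>a. 0) = 1\<^sub>m (p + q)"
  by (rule mat_eqI [of _ "p + q" "p + q"]) (auto simp: hyp_def cross_mat_entry angle_def)

lemma hyp_inverse:
  assumes "q \<le> p"
  shows "hyp p q t * hyp p q (\<lambda>a. - t a) = 1\<^sub>m (p + q)" "hyp p q (\<lambda>a. - t a) * hyp p q t = 1\<^sub>m (p + q)"
  using hyp_mult [OF assms, of t "\<lambda>a. - t a"] hyp_mult [OF assms, of "\<lambda>a. - t a" t]
  by (simp_all add: hyp_zero)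

text \<open>All entries are real numbers or real multiples of \<eta>, which
  \<open>quat_cnj_i\<close> fixes. The adjoint is thus the transpose, which exchanges the signs of
  the off-diagonal blocks.\<close>

lemma quat_adjoint_i_hyp:
  assumes "q \<le> p"
  shows "quat_adjoint_i (hyp p q t) = hyp p q (\<lambda>a. - t a)"
proof (rule mat_eqI [of _ "p + q" "p + q"])
  fix a b assume ab: "a < p + q" "b < p + q"
  show "quat_adjoint_i (hyp p q t) $$ (a, b) = hyp p q (\<lambda>a. - t a) $$ (a, b)"
    unfolding quat_adjoint_i_entry [OF hyp_carrier ab]
    using ab assms
    by (auto simp: hyp_def cross_mat_entry swap_outer_def angle_def block_sign_def eta_of_real)
qed simp_all

text \<open>The signature commutes with the cosh part and anticommutes with the sinh part.\<close>

lemma signature_mat_hyp: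
  assumes "q \<le> p"
  shows "signature_mat p q * hyp p q t = hyp p q (\<lambda>a. - t a) * signature_mat p q"
proof -
  have "of_real (block_sign p a) * hyp p q t $$ (a, b) = hyp p q (\<lambda>a. - t a) $$ (a, b) * of_real (block_sign p b)"
    if "a < p + q" "b < p + q" for a b
    using that assms by (auto simp: hyp_def cross_mat_entry swap_outer_def angle_def block_sign_def)
  then show ?thesis
    unfolding signature_mat_def mat_diag_mult_left [OF hyp_carrier] mat_diag_mult_right [OF hyp_carrier]
    by (intro mat_eqI [of _ "p + q" "p + q"]) auto
qed

text \<open>Moving the signature to the right of the last factor reverses its angles, so the two
  hyperbolic factors add up instead of cancelling.\<close>

lemma hyp_conj_signature:
  assumes "q \<le> p"
  shows "hyp p q t * signature_mat p q * hyp p q (\<lambda>a. - t a) = hyp p q (\<lambda>a. 2 * t a) * signature_mat p q"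
proof -
  have "hyp p q t * signature_mat p q * hyp p q (\<lambda>a. - t a) = hyp p q t * hyp p q t * signature_mat p q"
    using signature_mat_hyp [OF assms, of "\<lambda>a. - t a"]
    by (simp add: mult_square_assoc [where n = "p + q"])
  then show ?thesis unfolding hyp_mult [OF assms] mult_2 .
qed

text \<open>The signs at paired indices are opposite, so off the diagonal the product of both signs
  is -1. The result is a real diagonal first part, which carries the eigenvalues, and a symmetric
  second part.\<close>

lemma hyp_signature_pair:
  assumes "q \<le> p"
  shows "hyp p q t * signature_mat p q
    = pair_mat (mat_diag (p + q) (\<lambda>a. of_real (block_sign p a * cosh (angle p q t a))))
      (mat (p + q) (p + q) (\<lambda>(a, b). if b = swap_outer p q a then - of_real (sinh (angle p q t a)) else 0))"
proof (rule mat_eqI [of _ "p + q" "p + q"])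
  fix a b assume ab: "a < p + q" "b < p + q"
  then show "(hyp p q t * signature_mat p q) $$ (a, b) =
    pair_mat (mat_diag (p + q) (\<lambda>a. of_real (block_sign p a * cosh (angle p q t a))))
      (mat (p + q) (p + q) (\<lambda>(a, b). if b = swap_outer p q a then - of_real (sinh (angle p q t a)) else 0)) $$ (a, b)"
    unfolding signature_mat_def mat_diag_mult_right [OF hyp_carrier]
    using assms
    by (auto simp: pair_mat_def pair_def mat_diag_def hyp_def cross_mat_entry swap_outer_def angle_def
        block_sign_def)
qed simp_all

end

section \<open>Uniqueness of the angles\<close>

lemma char_poly_mat_diag:
  "char_poly (mat_diag n f) = (\<Prod>a<n. [:- f a, 1:])" for f :: "nat \<Rightarrow> 'a :: comm_ring_1"
proof -
  have "upper_triangular (mat_diag n f)" by (auto simp: mat_diag_def)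
  then have "char_poly (mat_diag n f) = (\<Prod>a\<leftarrow>diag_mat (mat_diag n f). [:- a, 1:])"
    by (rule char_poly_upper_triangular [OF mat_diag_dim])
  also have "diag_mat (mat_diag n f) = map f [0..<n]"
    by (simp add: diag_mat_def mat_diag_def)
  also have "(\<Prod>a\<leftarrow>map f [0..<n]. [:- a, 1:]) = (\<Prod>a<n. [:- f a, 1:])"
    by (simp add: comp_def prod.list_conv_set_nth atLeast0LessThan)
  finally show ?thesis .
qed

text \<open>Both diagonals list the roots of the same characteristic polynomial with
  multiplicity.\<close>

lemma diagonal_entries_unique:
  fixes d d' :: "nat \<Rightarrow> real"
  assumes U: "complex_unitary n U" and W: "complex_unitary n W"
    and eq: "U * mat_diag n (\<lambda>a. of_real (d a)) * mat_adjoint U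
      = W * mat_diag n (\<lambda>a. of_real (d' a)) * mat_adjoint W"
  shows "image_mset d (mset_set {..<n}) = image_mset d' (mset_set {..<n})"
proof -
  have cp: "char_poly (U * mat_diag n f * mat_adjoint U) = (\<Prod>a<n. [:- f a, 1:])"
    if "complex_unitary n U" for U f
  proof -
    note U = complex_unitaryD [OF that]
    have "similar_mat (U * mat_diag n f * mat_adjoint U) (mat_diag n f)"
      unfolding similar_mat_def
      using similar_mat_witI [OF U(4,3) refl _ mat_diag_dim U(1,2)] U by auto
    then show ?thesis by (simp add: char_poly_similar char_poly_mat_diag)
  qed
  have roots: "proots (\<Prod>a<n. [:- complex_of_real (f a), 1:])
      = image_mset (\<lambda>a. of_real (f a)) (mset_set {..<n})" for f
    by (subst proots_prod) (simp_all add: sum_unfold_sum_mset)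
  have "image_mset (\<lambda>a. complex_of_real (d a)) (mset_set {..<n})
      = image_mset (\<lambda>a. of_real (d' a)) (mset_set {..<n})"
    unfolding roots [symmetric] cp [OF U, of "\<lambda>a. of_real (d a)", symmetric]
      cp [OF W, of "\<lambda>a. of_real (d' a)", symmetric] eq ..
  from arg_cong [OF this, of "image_mset Re"] show ?thesis
    by (simp add: multiset.map_comp comp_def)
qed

text \<open>The negative values are exactly those at the last q indices, namely
  \<open>- cosh (2 * t a)\<close>. Filtering them out and applying arcosh recovers the absolute
  values of the angles.\<close>

lemma abs_angles_unique:
  fixes t t' :: "nat \<Rightarrow> real"
  assumes "q \<le> p"
    and eq: "image_mset (\<lambda>a. block_sign p a * cosh (angle p q (\<lambda>a. 2 * t a) a)) (mset_set {..<p + q})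
      = image_mset (\<lambda>a. block_sign p a * cosh (angle p q (\<lambda>a. 2 * t' a) a)) (mset_set {..<p + q})"
  shows "image_mset (\<lambda>a. \<bar>t a\<bar>) (mset_set {..<q}) = image_mset (\<lambda>a. \<bar>t' a\<bar>) (mset_set {..<q})"
proof -
  have neg: "image_mset (\<lambda>y. arcosh (- y) / 2) (filter_mset (\<lambda>y. y < 0)
      (image_mset (\<lambda>a. block_sign p a * cosh (angle p q (\<lambda>a. 2 * t a) a)) (mset_set {..<p + q})))
    = image_mset (\<lambda>a. \<bar>t a\<bar>) (mset_set {..<q})" for t :: "nat \<Rightarrow> real"
  proof -
    have "{a \<in> {..<p + q}. block_sign p a * cosh (angle p q (\<lambda>a. 2 * t a) a) < 0} = (\<lambda>a. p + a) ` {..<q}"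
      (is "?L = ?R")
    proof (intro equalityI subsetI)
      fix a assume "a \<in> ?L"
      moreover have "\<not> cosh x < 0" for x :: real
        by (simp add: not_less)
      ultimately have "a < p + q" "p \<le> a"
        by (auto simp: block_sign_def split: if_splits)
      then show "a \<in> ?R" by (intro image_eqI [of _ _ "a - p"]) auto
    qed (auto simp: block_sign_def)
    then have "filter_mset (\<lambda>y. y < 0)
        (image_mset (\<lambda>a. block_sign p a * cosh (angle p q (\<lambda>a. 2 * t a) a)) (mset_set {..<p + q}))
      = image_mset (\<lambda>a. block_sign p a * cosh (angle p q (\<lambda>a. 2 * t a) a)) (mset_set ((\<lambda>a. p + a) ` {..<q}))"
      by (simp add: filter_mset_image_mset filter_mset_mset_set)
    also have "mset_set ((\<lambda>a. p + a) ` {..<q}) = image_mset (\<lambda>a. p + a) (mset_set {..<q})"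
      by (simp add: image_mset_mset_set)
    finally have "filter_mset (\<lambda>y. y < 0)
        (image_mset (\<lambda>a. block_sign p a * cosh (angle p q (\<lambda>a. 2 * t a) a)) (mset_set {..<p + q}))
      = image_mset (\<lambda>a. - cosh (2 * \<bar>t a\<bar>)) (mset_set {..<q})"
      using assms(1) by (simp add: multiset.map_comp comp_def block_sign_def angle_def abs_if if_distrib
          cong: if_cong)
    then show ?thesis by (simp add: multiset.map_comp comp_def arcosh_cosh_real)
  qed
  show ?thesis using neg [of t] neg [of t'] by (simp only: eq)
qed

lemma eq_up_to_order_and_signsI:
  assumes "image_mset (\<lambda>a. \<bar>\<theta> $ a\<bar>) (mset_set {..<q}) = image_mset (\<lambda>a. \<bar>\<theta>' $ a\<bar>) (mset_set {..<q})"
  shows "eq_up_to_order_and_signs q \<theta> \<theta>'"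
proof -
  obtain \<pi> where \<pi>: "\<pi> permutes {..<q}" "\<forall>a\<in>{..<q}. \<bar>\<theta>' $ a\<bar> = \<bar>\<theta> $ \<pi> a\<bar>"
    using image_mset_eq_implies_permutes [OF _ assms [symmetric]] by auto
  \<comment> \<open>If the two values differ, equal absolute values force them to be
    opposite.\<close>
  define s :: "nat \<Rightarrow> real" where "s a = (if \<theta>' $ a = \<theta> $ \<pi> a then 1 else - 1)" for a
  have "\<forall>a<q. s a \<in> {1, - 1} \<and> \<theta>' $ a = s a * \<theta> $ \<pi> a"
    using \<pi>(2) by (auto simp: s_def abs_eq_iff)
  with \<pi>(1) show ?thesis unfolding eq_up_to_order_and_signs_def by blast
qed

section \<open>Orthogonal block-diagonal matrices and the involution of a factorization\<close>

context perp_unit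
begin

lemma quat_orthogonalD:
  assumes "quat_orthogonal n M"
  shows "M \<in> carrier_mat n n" "quat_adjoint_i M \<in> carrier_mat n n"
    "quat_adjoint_i M * M = 1\<^sub>m n" "M * quat_adjoint_i M = 1\<^sub>m n"
  using assms quat_mat_left_right_inverse [of "quat_adjoint_i M" n M]
  by (auto simp: quat_orthogonal_def)

lemma quat_adjoint_i_block_diag:
  assumes A: "A \<in> carrier_mat p p" and D: "D \<in> carrier_mat q q"
  shows "quat_adjoint_i (four_block_mat A (0\<^sub>m p q) (0\<^sub>m q p) D)
    = four_block_mat (quat_adjoint_i A) (0\<^sub>m p q) (0\<^sub>m q p) (quat_adjoint_i D)"
proof (rule mat_eqI)
  have c: "four_block_mat A (0\<^sub>m p q) (0\<^sub>m q p) D \<in> carrier_mat (p + q) (p + q)"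
    using A D by simp
  then show "quat_adjoint_i (four_block_mat A (0\<^sub>m p q) (0\<^sub>m q p) D) \<in> carrier_mat (p + q) (p + q)"
    by simp
  note A' = quat_adjoint_i_carrier [OF A] and D' = quat_adjoint_i_carrier [OF D]
  then show "four_block_mat (quat_adjoint_i A) (0\<^sub>m p q) (0\<^sub>m q p) (quat_adjoint_i D)
      \<in> carrier_mat (p + q) (p + q)"
    by simp
  fix a b assume "a < p + q" "b < p + q"
  then show "quat_adjoint_i (four_block_mat A (0\<^sub>m p q) (0\<^sub>m q p) D) $$ (a, b)
    = four_block_mat (quat_adjoint_i A) (0\<^sub>m p q) (0\<^sub>m q p) (quat_adjoint_i D) $$ (a, b)"
    using A D carrier_matD [OF A'] carrier_matD [OF D']
    by (simp add: quat_adjoint_i_entry [OF c] quat_adjoint_i_entry [OF A] quat_adjoint_i_entry [OF D])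
qed

lemma quat_adjoint_i_block_diag_mult:
  assumes A: "A \<in> carrier_mat p p" and D: "D \<in> carrier_mat q q"
  shows "quat_adjoint_i (four_block_mat A (0\<^sub>m p q) (0\<^sub>m q p) D) * four_block_mat A (0\<^sub>m p q) (0\<^sub>m q p) D
    = four_block_mat (quat_adjoint_i A * A) (0\<^sub>m p q) (0\<^sub>m q p) (quat_adjoint_i D * D)"
  unfolding quat_adjoint_i_block_diag [OF assms]
  using quat_adjoint_i_carrier [OF A] quat_adjoint_i_carrier [OF D] A D
  by (subst mult_four_block_mat [of _ p p _ q _ q _ _ p _ q])
    (auto simp: right_mult_zero_mat [OF quat_adjoint_i_carrier [OF A]]
      right_mult_zero_mat [OF quat_adjoint_i_carrier [OF D]])

lemma block_diag_orthogonal: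
  assumes "quat_orthogonal p A" "quat_orthogonal q D"
  shows "quat_orthogonal (p + q) (four_block_mat A (0\<^sub>m p q) (0\<^sub>m q p) D)"
  using quat_orthogonalD [OF assms(1)] quat_orthogonalD [OF assms(2)]
  by (simp add: quat_orthogonal_def quat_adjoint_i_block_diag_mult)

lemma block_diag_signature:
  assumes A: "A \<in> carrier_mat p p" and D: "D \<in> carrier_mat q q"
  shows "four_block_mat A (0\<^sub>m p q) (0\<^sub>m q p) D * signature_mat p q
    = signature_mat p q * four_block_mat A (0\<^sub>m p q) (0\<^sub>m q p) D"
proof -
  have c: "four_block_mat A (0\<^sub>m p q) (0\<^sub>m q p) D \<in> carrier_mat (p + q) (p + q)"
    using A D by simp
  show ?thesis
    unfolding signature_mat_def mat_diag_mult_left [OF c] mat_diag_mult_right [OF c]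
    by (rule mat_eqI [of _ "p + q" "p + q"]) (use A D in \<open>auto simp: block_sign_def\<close>)
qed

lemma unitary_quat:
  assumes "complex_unitary n U"
  shows "quat_orthogonal n (map_mat quat_of_complex U)"
  using complex_unitaryD [OF assms]
  by (simp add: quat_orthogonal_def quat_adjoint_i_of_complex [where n = n and m = n]
      map_quat_of_complex_one flip: map_quat_of_complex_mult [where n = n and m = n and k = n])

text \<open>The left side depends on M alone, so this is the identity through which two
  factorizations of M are compared.\<close>

lemma factorization_involution:
  assumes "q \<le> p" and "hyperbolic_factorization p q \<eta> M U \<theta> V\<^sub>p V\<^sub>q"
  shows "M * signature_mat p q * quat_adjoint_i M
    = map_mat quat_of_complex U * (hyp p q (\<lambda>a. 2 * \<theta> $ a) * signature_mat p q)
      * quat_adjoint_i (map_mat quat_of_complex U)"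
proof -
  define V where "V = four_block_mat V\<^sub>p (0\<^sub>m p q) (0\<^sub>m q p) V\<^sub>q"
  let ?U = "map_mat quat_of_complex U" and ?H = "hyp p q (\<lambda>a. \<theta> $ a)" and ?J = "signature_mat p q"
  from assms have fact: "complex_unitary (p + q) U" "quat_orthogonal p V\<^sub>p" "quat_orthogonal q V\<^sub>q"
    and M: "M = ?U * ?H * V"
    by (auto simp: hyperbolic_factorization_def hyperbolic_mat_eq_hyp V_def)
  note U = quat_orthogonalD [OF unitary_quat [OF fact(1)]]
  note V = quat_orthogonalD [OF block_diag_orthogonal [OF fact(2,3)], folded V_def]
  have VJ: "V * ?J = ?J * V"
    unfolding V_def using fact by (intro block_diag_signature) (auto dest: quat_orthogonalD)
  note [simp] = mult_square_assoc [where n = "p + q"] quat_adjoint_i_mult [where n = "p + q" and m = "p + q" and k = "p + q"]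
  have "M * ?J * quat_adjoint_i M
      = ?U * ?H * (V * ?J) * quat_adjoint_i V * quat_adjoint_i ?H * quat_adjoint_i ?U"
    unfolding M using U(1,2) V(1,2) by simp
  also have "\<dots> = ?U * ?H * ?J * (V * quat_adjoint_i V) * quat_adjoint_i ?H * quat_adjoint_i ?U"
    unfolding VJ using U(1,2) V(1,2) by simp
  also have "\<dots> = ?U * (?H * ?J * quat_adjoint_i ?H) * quat_adjoint_i ?U"
    unfolding V(4) using U(1,2) V(1,2) by simp
  also have "?H * ?J * quat_adjoint_i ?H = hyp p q (\<lambda>a. 2 * \<theta> $ a) * ?J"
    unfolding quat_adjoint_i_hyp [OF assms(1)] hyp_conj_signature [OF assms(1)] ..
  finally show ?thesis .
qed

lemma of_complex_mult_pair_mat: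
  assumes U: "U \<in> carrier_mat n n" and A: "A \<in> carrier_mat n n" and B: "B \<in> carrier_mat n n"
  shows "map_mat quat_of_complex U * pair_mat A B = pair_mat (U * A) (U * B)"
proof -
  have z: "0\<^sub>m n n \<in> carrier_mat n n" by simp
  show ?thesis
    unfolding pair_mat_of_complex [OF U, symmetric] pair_mat_mult [OF U z A B]
    using A B U by (intro arg_cong2 [where f = pair_mat]) (auto simp: left_mult_zero_mat [where n = n])
qed

lemma pair_mat_mult_of_complex:
  assumes U: "U \<in> carrier_mat n n" and A: "A \<in> carrier_mat n n" and B: "B \<in> carrier_mat n n"
  shows "pair_mat A B * map_mat quat_of_complex U = pair_mat (A * U) (B * map_mat cnj U)"
proof -
  have z: "0\<^sub>m n n \<in> carrier_mat n n" by simp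
  show ?thesis
    unfolding pair_mat_of_complex [OF U, symmetric] pair_mat_mult [OF A B U z]
    using A B U by (intro arg_cong2 [where f = pair_mat]) (auto simp: right_mult_zero_mat [where nr = n])
qed

text \<open>Since \<eta> conjugates what passes it, a complex unitary matrix acts by similarity on
  the first part but by the congruence with its transpose on the second.\<close>

lemma unitary_conj_pair_mat:
  assumes U: "U \<in> carrier_mat n n" and A: "A \<in> carrier_mat n n" and B: "B \<in> carrier_mat n n"
  shows "map_mat quat_of_complex U * pair_mat A B * quat_adjoint_i (map_mat quat_of_complex U)
    = pair_mat (U * A * mat_adjoint U) (U * B * map_mat cnj (mat_adjoint U))"
  using assms
  by (simp add: quat_adjoint_i_of_complex of_complex_mult_pair_mat [where n = n]
      pair_mat_mult_of_complex [where n = n])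

lemma angles_unique:
  assumes qp: "q \<le> p" and "hyperbolic_factorization p q \<eta> M U \<theta> V\<^sub>p V\<^sub>q"
    and "hyperbolic_factorization p q \<eta> M U' \<theta>' V\<^sub>p' V\<^sub>q'"
  shows "eq_up_to_order_and_signs q \<theta> \<theta>'"
proof -
  \<comment> \<open>The second part \<open>B\<close> is left unspecified, because the first part
    already carries the angles.\<close>
  have key: "\<exists>B \<in> carrier_mat (p + q) (p + q). M * signature_mat p q * quat_adjoint_i M = pair_mat
      (U * mat_diag (p + q) (\<lambda>a. of_real (block_sign p a * cosh (angle p q (\<lambda>a. 2 * \<theta> $ a) a)))
        * mat_adjoint U) B \<and> complex_unitary (p + q) U"
    if "hyperbolic_factorization p q \<eta> M U \<theta> V\<^sub>p V\<^sub>q" for U \<theta> V\<^sub>p V\<^sub>q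
  proof -
    from that have Uu: "complex_unitary (p + q) U" by (simp add: hyperbolic_factorization_def)
    note U = complex_unitaryD(1,2) [OF Uu]
    show ?thesis
      unfolding factorization_involution [OF qp that] hyp_signature_pair [OF qp]
      unfolding unitary_conj_pair_mat [OF U(1) mat_diag_dim mat_carrier]
      by (rule bexI, rule conjI, rule refl, rule Uu)
        (intro mult_square_carrier map_carrier_mat [THEN iffD2] U mat_carrier)
  qed
  \<comment> \<open>Equality of the first parts yields two unitary diagonalizations of one complex
    matrix.\<close>
  from key [OF assms(2)] key [OF assms(3)]
  have "complex_unitary (p + q) U" "complex_unitary (p + q) U'"
    "U * mat_diag (p + q) (\<lambda>a. of_real (block_sign p a * cosh (angle p q (\<lambda>a. 2 * \<theta> $ a) a))) * mat_adjoint U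
    = U' * mat_diag (p + q) (\<lambda>a. of_real (block_sign p a * cosh (angle p q (\<lambda>a. 2 * \<theta>' $ a) a))) * mat_adjoint U'"
    by (auto simp: pair_mat_eq_iff [where n = "p + q" and m = "p + q"] complex_unitaryD(1,2))
  then show ?thesis
    by (intro eq_up_to_order_and_signsI abs_angles_unique [OF qp] diagonal_entries_unique)
qed

end

section \<open>Existence of the factorization\<close>

lemma down_closed_eq_lessThan:
  fixes S :: "nat set"
  assumes "finite S" and down: "\<And>a b. a \<le> b \<Longrightarrow> b \<in> S \<Longrightarrow> a \<in> S"
  shows "S = {..<card S}"
proof (intro equalityI subsetI)
  fix a assume "a \<in> S"
  then have "{..a} \<subseteq> S" using down by auto
  then have "card {..a} \<le> card S" using assms(1) by (rule card_mono [rotated])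
  then show "a \<in> {..<card S}" by simp
next
  fix a assume "a \<in> {..<card S}"
  show "a \<in> S"
  proof (rule ccontr)
    assume "a \<notin> S"
    then have "S \<subseteq> {..<a}" using down by (meson lessThan_iff not_le subsetI)
    then have "card S \<le> a" using card_mono [of "{..<a}" S] by simp
    with \<open>a \<in> {..<card S}\<close> show False by simp
  qed
qed

lemma sum_sgn:
  fixes d :: "nat \<Rightarrow> real"
  shows "(\<Sum>a<n. sgn (d a)) = real (card {a. a < n \<and> 0 < d a}) - real (card {a. a < n \<and> d a < 0})"
proof -
  have "(\<Sum>a<n. sgn (d a)) = (\<Sum>a<n. (if 0 < d a then 1 else 0) - (if d a < 0 then 1 else 0))"
    by (intro sum.cong) (auto simp: sgn_if)
  then show ?thesis
    by (simp add: sum_subtractf sum.If_cases Int_def)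
qed

text \<open>The situation once X is diagonal: the involution is T = D + Y \<eta> with D = diag(d).
  \<open>Y_sym\<close> expresses self-adjointness, \<open>Y_square\<close> and \<open>Y_anti\<close>
  are the two components of T^2 = I, and \<open>trace\<close> is the real part of the trace of
  T.\<close>

locale sorted_pairing =
  fixes p q :: nat and d :: "nat \<Rightarrow> real" and Y :: "complex mat"
  assumes sorted: "a \<le> b \<Longrightarrow> b < p + q \<Longrightarrow> d b \<le> d a"
    and Y: "Y \<in> carrier_mat (p + q) (p + q)"
    and Y_sym: "a < p + q \<Longrightarrow> b < p + q \<Longrightarrow> Y $$ (a, b) = Y $$ (b, a)"
    and Y_square: "a < p + q \<Longrightarrow> b < p + q \<Longrightarrow>
      (\<Sum>c<p + q. Y $$ (a, c) * cnj (Y $$ (c, b))) = (if a = b then of_real ((d a)\<^sup>2 - 1) else 0)"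
    and Y_anti: "a < p + q \<Longrightarrow> b < p + q \<Longrightarrow> Y $$ (a, b) \<noteq> 0 \<Longrightarrow> d b = - d a"
    and trace: "(\<Sum>a<p + q. d a) = real p - real q"
    and qp: "q \<le> p"
begin

abbreviation "n \<equiv> p + q"

text \<open>As Y is symmetric, Y cnj(Y) is the product of Y with its adjoint, and its diagonal holds
  the squared row norms.\<close>

lemma row_norm: "(\<Sum>b<n. (cmod (Y $$ (a, b)))\<^sup>2) = (d a)\<^sup>2 - 1" if "a < n"
proof -
  have "complex_of_real (\<Sum>b<n. (cmod (Y $$ (a, b)))\<^sup>2) = (\<Sum>c<n. Y $$ (a, c) * cnj (Y $$ (c, a)))"
    unfolding of_real_sum complex_norm_square using that Y_sym by (intro sum.cong) auto
  also have "\<dots> = of_real ((d a)\<^sup>2 - 1)" using Y_square [OF that that] by simp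
  finally show ?thesis by (simp only: of_real_eq_iff)
qed

lemma d_square_ge: "1 \<le> (d a)\<^sup>2" if "a < n"
  using row_norm [OF that] sum_nonneg [of "{..<n}" "\<lambda>b. (cmod (Y $$ (a, b)))\<^sup>2"] by simp

lemma abs_d_ge: "1 \<le> \<bar>d a\<bar>" if "a < n"
  using d_square_ge [OF that] by (metis abs_1 abs_le_square_iff one_power2)

lemma Y_zero: "Y $$ (a, b) = 0" if "\<bar>d b\<bar> = 1" "a < n" "b < n"
proof -
  have "(d b)\<^sup>2 = 1" using that(1) by (metis power2_abs one_power2)
  then have "(\<Sum>c<n. (cmod (Y $$ (b, c)))\<^sup>2) = 0"
    using row_norm [OF that(3)] by simp
  then have "Y $$ (b, a) = 0" using that(2) by (subst (asm) sum_nonneg_eq_0_iff) auto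
  then show ?thesis using Y_sym that by simp
qed

text \<open>Double counting: the weights \<open>|Y(a,b)|\<^sup>2 / (d(a)\<^sup>2 - 1)\<close> are symmetric, sum to 1 along every row
  with \<open>|d(a)| > 1\<close>, and pair \<open>d(a)\<close> only with \<open>-d(a)\<close>.\<close>

lemma sum_odd:
  fixes g :: "real \<Rightarrow> real"
  assumes odd: "\<And>x. g (- x) = - g x"
  shows "(\<Sum>a<n. if \<bar>d a\<bar> = 1 then 0 else g (d a)) = 0"
proof -
  define h where "h a b = g (d a) * (cmod (Y $$ (a, b)))\<^sup>2 / ((d a)\<^sup>2 - 1)" for a b
  have h: "h a b = - h b a" if "a < n" "b < n" for a b
    using Y_anti [OF that] Y_sym [OF that] by (cases "Y $$ (a, b) = 0") (auto simp: h_def odd)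
  have "(\<Sum>a<n. if \<bar>d a\<bar> = 1 then 0 else g (d a)) = (\<Sum>a<n. \<Sum>b<n. h a b)"
  proof (intro sum.cong refl)
    fix a assume "a \<in> {..<n}"
    then have "(\<Sum>b<n. h a b) = g (d a) * ((d a)\<^sup>2 - 1) / ((d a)\<^sup>2 - 1)"
      unfolding h_def by (simp add: row_norm flip: sum_divide_distrib sum_distrib_left)
    \<comment> \<open>If \<open>d a\<close> is 1 or -1, division by 0 gives 0, which matches the
      omitted terms.\<close>
    then show "(if \<bar>d a\<bar> = 1 then 0 else g (d a)) = (\<Sum>b<n. h a b)"
      by (auto simp: power2_eq_1_iff abs_if)
  qed
  moreover have "(\<Sum>a<n. \<Sum>b<n. h a b) = - (\<Sum>a<n. \<Sum>b<n. h a b)"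
  proof -
    have "(\<Sum>a<n. \<Sum>b<n. h a b) = (\<Sum>b<n. \<Sum>a<n. h a b)" by (rule sum.swap)
    also have "\<dots> = (\<Sum>b<n. \<Sum>a<n. - h b a)" by (intro sum.cong refl h) auto
    finally show ?thesis by (simp add: sum_negf)
  qed
  ultimately show ?thesis by simp
qed

text \<open>By \<open>card_gt_1\<close> this also counts the eigenvalues above 1, hence the nonzero
  angles.\<close>

definition "\<alpha> = card {a. a < n \<and> d a < - 1}"

text \<open>The function x - sgn x is odd and vanishes at 1 and -1, so by \<open>sum_odd\<close> the
  signs of the eigenvalues have the same sum p - q as the eigenvalues. No eigenvalue is 0, so the
  numbers of positive and negative ones add up to p + q.\<close>

lemma card_pos: "card {a. a < n \<and> 0 < d a} = p"
proof -
  have "(\<Sum>a<n. d a) - (\<Sum>a<n. sgn (d a))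
      = (\<Sum>a<n. if \<bar>d a\<bar> = 1 then 0 else d a - sgn (d a))"
    unfolding sum_subtractf [symmetric] by (intro sum.cong) (auto simp: sgn_if abs_if)
  also have "\<dots> = 0" by (rule sum_odd [of "\<lambda>x. x - sgn x"]) (simp add: sgn_minus)
  finally have diff: "real (card {a. a < n \<and> 0 < d a}) - real (card {a. a < n \<and> d a < 0}) = real p - real q"
    using trace by (simp add: sum_sgn)
  have "d a \<noteq> 0" if "a < n" for a
    using abs_d_ge [OF that] by auto
  then have "{a. a < n \<and> 0 < d a} \<union> {a. a < n \<and> d a < 0} = {..<n}" by force
  moreover have "card ({a. a < n \<and> 0 < d a} \<union> {a. a < n \<and> d a < 0})
      = card {a. a < n \<and> 0 < d a} + card {a. a < n \<and> d a < 0}"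
    by (rule card_Un_disjoint) auto
  ultimately have "card {a. a < n \<and> 0 < d a} + card {a. a < n \<and> d a < 0} = p + q" by simp
  with diff show ?thesis by linarith
qed

text \<open>As d is decreasing, the positive values occupy an initial segment of the
  indices.\<close>

lemma pos_iff: "0 < d a \<longleftrightarrow> a < p" if "a < n"
proof -
  have "{a. a < n \<and> 0 < d a} = {..<p}"
    using down_closed_eq_lessThan [of "{a. a < n \<and> 0 < d a}"] sorted
    unfolding card_pos by force
  then show ?thesis using that by auto
qed

lemma card_gt_1: "card {a. a < n \<and> 1 < d a} = \<alpha>"
proof -
  \<comment> \<open>Replacing 1 and -1 by 0 turns the sign count into a comparison of the values
    above 1 with those below -1.\<close>
  define e where "e a = (if \<bar>d a\<bar> = 1 then 0 else d a)" for a
  have "(\<Sum>a<n. sgn (e a)) = (\<Sum>a<n. if \<bar>d a\<bar> = 1 then 0 else sgn (d a))"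
    by (intro sum.cong) (auto simp: e_def)
  also have "\<dots> = 0" by (rule sum_odd) (simp add: sgn_minus)
  finally have "card {a. a < n \<and> 0 < e a} = card {a. a < n \<and> e a < 0}"
    by (simp add: sum_sgn)
  moreover have "{a. a < n \<and> 0 < e a} = {a. a < n \<and> 1 < d a}" "{a. a < n \<and> e a < 0} = {a. a < n \<and> d a < - 1}"
    using abs_d_ge by (force simp: e_def abs_if split: if_splits)+
  ultimately show ?thesis by (simp add: \<alpha>_def)
qed

lemma gt_1_iff: "1 < d a \<longleftrightarrow> a < \<alpha>" if "a < n"
proof -
  have "{a. a < n \<and> 1 < d a} = {..<\<alpha>}"
    using down_closed_eq_lessThan [of "{a. a < n \<and> 1 < d a}"] sorted
    unfolding card_gt_1 by force
  then show ?thesis using that by auto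
qed

lemma lt_minus_1_iff: "d a < - 1 \<longleftrightarrow> n - \<alpha> \<le> a" if "a < n"
proof -
  have "{a. a < n \<and> \<not> d a < - 1} = {..<n} - {a. a < n \<and> d a < - 1}" by auto
  then have card: "card {a. a < n \<and> \<not> d a < - 1} = n - \<alpha>"
    unfolding \<alpha>_def by (simp, subst card_Diff_subset) auto
  have "{a. a < n \<and> \<not> d a < - 1} = {..<card {a. a < n \<and> \<not> d a < - 1}}"
  proof (rule down_closed_eq_lessThan)
    show "a \<in> {a. a < n \<and> \<not> d a < - 1}" if "a \<le> b" "b \<in> {a. a < n \<and> \<not> d a < - 1}" for a b
      using that sorted [of a b] by auto
  qed simp
  then have "{a. a < n \<and> \<not> d a < - 1} = {..<n - \<alpha>}" unfolding card .
  from arg_cong [OF this, of "\<lambda>S. a \<in> S"] show ?thesis using that by (simp add: not_le) linarith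
qed

lemma \<alpha>_le: "\<alpha> \<le> q"
proof -
  have "{a. a < n \<and> d a < - 1} \<subseteq> {p..<n}" using pos_iff by force
  then have "\<alpha> \<le> card {p..<n}" unfolding \<alpha>_def by (intro card_mono) auto
  then show ?thesis by simp
qed

lemma d_eq_1: "d a = 1" if "\<alpha> \<le> a" "a < p"
  using gt_1_iff [of a] pos_iff [of a] abs_d_ge [of a] that by auto

lemma d_eq_minus_1: "d a = - 1" if "p \<le> a" "a < n - \<alpha>"
proof -
  have "a < n" using that by simp
  then show ?thesis using lt_minus_1_iff [of a] pos_iff [of a] abs_d_ge [of a] that by auto
qed

section \<open>The unitary basis that pairs opposite eigenspaces\<close>

definition "s a = sqrt ((d a)\<^sup>2 - 1)"

lemma s_square: "s a * s a = (d a)\<^sup>2 - 1" if "a < n"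
  using d_square_ge [OF that] by (simp add: s_def)

lemma s_pos: "0 < s a" if "a < \<alpha>"
proof -
  have "1 < d a" using gt_1_iff [of a] that \<alpha>_le by auto
  then show ?thesis by (simp add: s_def one_less_power)
qed

text \<open>Halved because the normal form of the involution carries doubled angles.\<close>

definition "t a = arcosh (d a) / 2"

lemma cosh_t: "cosh (2 * t a) = d a" and sinh_t: "sinh (2 * t a) = s a" if "a < p"
proof -
  have "1 \<le> d a" using pos_iff [of a] abs_d_ge [of a] that by auto
  then show c: "cosh (2 * t a) = d a" and "sinh (2 * t a) = s a"
    using cosh_square_eq [of "arcosh (d a)"] by (simp_all add: t_def s_def)
qed

text \<open>Column b of the new basis. The unit vectors for positive eigenvalues are kept. For a <
  \<alpha>, column p + a is minus the normalized image of unit vector a under v -> Y cnj(v), an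
  eigenvector for \<open>- d a\<close>; its norm before scaling is \<open>s a\<close> by
  \<open>row_norm\<close>. These images replace the last \<alpha> unit vectors, and the unit vectors
  for -1 move up by \<alpha> places.\<close>

definition "u a b = (if b < p then of_bool (a = b) else if b < p + \<alpha> then - Y $$ (a, b - p) / of_real (s (b - p))
  else of_bool (a = b - \<alpha>))"

definition "U = mat n n (\<lambda>(a, b). u a b)"

lemma U: "U \<in> carrier_mat n n" and U_entry: "a < n \<Longrightarrow> b < n \<Longrightarrow> U $$ (a, b) = u a b"
  by (simp_all add: U_def)

lemma u_support: "d a = - d (b - p)" if "p \<le> b" "b < p + \<alpha>" "a < n" "u a b \<noteq> 0"
proof -
  have "Y $$ (b - p, a) \<noteq> 0" using that \<alpha>_le Y_sym [of a "b - p"] qp by (auto simp: u_def split: if_splits)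
  then show ?thesis using Y_anti [of "b - p" a] that \<alpha>_le by simp
qed

text \<open>The images belong to eigenvalues below -1, so they live on the last \<alpha>
  coordinates.\<close>

lemma u_zero: "u a b = 0" if "p \<le> b" "b < p + \<alpha>" "a < n - \<alpha>"
proof (rule ccontr)
  assume "u a b \<noteq> 0"
  then have "d a = - d (b - p)" using u_support that by simp
  moreover have "1 < d (b - p)" using gt_1_iff [of "b - p"] that \<alpha>_le by auto
  moreover have "a < n" using that by simp
  ultimately show False using lt_minus_1_iff [of a] that by auto
qed

text \<open>Every column other than an image is a unit vector, and by \<open>u_zero\<close> the
  images vanish in its row c. Hence that row is a unit vector too, which settles orthogonality with
  all other columns.\<close>

lemma u_unit_column:
  assumes "b < n" "\<not> (p \<le> b \<and> b < p + \<alpha>)"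
  obtains c where "c < n - \<alpha>" "\<And>a. u a b = of_bool (a = c)"
    "\<And>b'. b' < n \<Longrightarrow> u c b' = of_bool (b = b')" "c = b \<and> b < p \<or> c = b - \<alpha> \<and> p + \<alpha> \<le> b"
proof -
  define c where "c = (if b < p then b else b - \<alpha>)"
  have c: "c < n - \<alpha>" using assms \<alpha>_le by (auto simp: c_def)
  moreover have "u a b = of_bool (a = c)" for a using assms by (auto simp: u_def c_def)
  moreover have "u c b' = of_bool (b = b')" if "b' < n" for b'
  proof (cases "p \<le> b' \<and> b' < p + \<alpha>")
    case True
    then show ?thesis using u_zero [of b' c] c assms(2) by auto
  next
    case False
    then show ?thesis using assms by (auto simp: u_def c_def)
  qed
  moreover have "c = b \<and> b < p \<or> c = b - \<alpha> \<and> p + \<alpha> \<le> b" using assms(2) by (auto simp: c_def)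
  ultimately show ?thesis by (rule that)
qed

lemma u_orthonormal: "(\<Sum>c<n. cnj (u c a) * u c b) = of_bool (a = b)" if ab: "a < n" "b < n"
proof -
  consider "\<not> (p \<le> a \<and> a < p + \<alpha>)" | "\<not> (p \<le> b \<and> b < p + \<alpha>)"
    | "p \<le> a" "a < p + \<alpha>" "p \<le> b" "b < p + \<alpha>" by blast
  then show ?thesis
  proof cases
    case 1
    obtain e where e: "e < n - \<alpha>" "\<And>c. u c a = of_bool (c = e)" "\<And>b'. b' < n \<Longrightarrow> u e b' = of_bool (a = b')"
      using u_unit_column [OF ab(1) 1] by metis
    have "(\<Sum>c<n. cnj (u c a) * u c b) = (\<Sum>c<n. if c = e then u e b else 0)"
      by (intro sum.cong) (simp_all add: e(2))
    moreover have "e < n" using e(1) by simp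
    ultimately show ?thesis using e(3) [OF ab(2)] by simp
  next
    case 2
    obtain e where e: "e < n - \<alpha>" "\<And>c. u c b = of_bool (c = e)" "\<And>b'. b' < n \<Longrightarrow> u e b' = of_bool (b = b')"
      using u_unit_column [OF ab(2) 2] by metis
    have "(\<Sum>c<n. cnj (u c a) * u c b) = (\<Sum>c<n. if c = e then cnj (u e a) else 0)"
      by (intro sum.cong) (simp_all add: e(2))
    moreover have "e < n" using e(1) by simp
    ultimately show ?thesis using e(3) [OF ab(1)] by auto
  next
    case 3
    have lt: "a - p < n" "b - p < n" using ab by auto
    \<comment> \<open>The inner product of two images is, up to scaling, an entry of Y cnj(Y), which
      is diagonal with entries \<open>s a * s a\<close>.\<close>
    have "(\<Sum>c<n. cnj (u c a) * u c b)
        = (\<Sum>c<n. Y $$ (b - p, c) * cnj (Y $$ (c, a - p))) / of_real (s (a - p) * s (b - p))"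
      unfolding sum_divide_distrib using 3 Y_sym [OF _ lt(2)] by (intro sum.cong) (auto simp: u_def)
    also have "\<dots> = of_bool (a = b)"
    proof (cases "a = b")
      case True
      have "0 < s (a - p)" using 3 by (intro s_pos) linarith
      then show ?thesis
        unfolding Y_square [OF lt(2,1)] using True by (simp flip: s_square [OF lt(2)] del: of_real_diff)
    next
      case False
      then show ?thesis using 3 by (simp add: Y_square [OF lt(2,1)])
    qed
    finally show ?thesis .
  qed
qed

lemma U_unitary: "complex_unitary n U"
proof -
  have "mat_adjoint U * U = 1\<^sub>m n"
  proof (rule mat_eqI [of _ n n])
    fix a b assume ab: "a < n" "b < n"
    have "(mat_adjoint U * U) $$ (a, b) = (\<Sum>c<n. cnj (u c a) * u c b)"
      unfolding mult_mat_entry [OF mat_adjoint_carrier [OF U] U ab]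
      using ab by (intro sum.cong) (simp_all add: mat_adjoint_entry [OF U] U_entry)
    then show "(mat_adjoint U * U) $$ (a, b) = 1\<^sub>m n $$ (a, b)" using u_orthonormal ab by simp
  qed (use U in simp_all)
  then show ?thesis using U by (simp add: complex_unitary_def)
qed

text \<open>Column by column, U consists of eigenvectors of D, listed in the order in which the
  eigenvalues occur in the normal form.\<close>

lemma diag_U:
  "mat_diag n (\<lambda>a. of_real (d a)) * U
    = U * mat_diag n (\<lambda>a. of_real (block_sign p a * cosh (angle p q (\<lambda>a. 2 * t a) a)))"
proof -
  have "of_real (d a) * u a b = u a b * of_real (block_sign p b * cosh (angle p q (\<lambda>a. 2 * t a) b))"
    if ab: "a < n" "b < n" for a b
  proof (cases "p \<le> b \<and> b < p + \<alpha>")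
    case True
    then have "u a b = 0 \<or> d a = - d (b - p)" using u_support ab by blast
    then show ?thesis using True \<alpha>_le qp by (auto simp: angle_def block_sign_def cosh_t)
  next
    case False
    then consider "b < p" | "p + \<alpha> \<le> b" by linarith
    then show ?thesis
    proof cases
      case 1
      then have "cosh (angle p q (\<lambda>a. 2 * t a) b) = d b"
        using d_eq_1 [of b] \<alpha>_le by (auto simp: angle_def cosh_t)
      then show ?thesis using 1 by (auto simp: u_def block_sign_def)
    next
      \<comment> \<open>Here the partner index \<open>b - p\<close> is at least \<alpha>, so its
        angle is 0, and the column is a unit vector for the eigenvalue -1.\<close>
      case 2
      then have "cosh (angle p q (\<lambda>a. 2 * t a) b) = 1" "d (b - \<alpha>) = - 1"
        using ab qp d_eq_1 [of "b - p"] d_eq_minus_1 [of "b - \<alpha>"] by (auto simp: angle_def cosh_t)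
      then show ?thesis using 2 by (auto simp: u_def block_sign_def)
    qed
  qed
  then show ?thesis
    unfolding mat_diag_mult_left [OF U] mat_diag_mult_right [OF U]
    by (intro mat_eqI [of _ n n]) (auto simp: U_entry)
qed

text \<open>The map v -> Y cnj(v) sends unit vector a < \<alpha> to \<open>- s a\<close> times
  column p + a by construction, and sends that column back to \<open>- s a\<close> times the unit
  vector because Y cnj(Y) = D^2 - I. The remaining columns are killed.\<close>

lemma Y_U:
  "Y * map_mat cnj U
    = U * mat n n (\<lambda>(a, b). if b = swap_outer p q a then - of_real (sinh (angle p q (\<lambda>a. 2 * t a) a)) else 0)"
    (is "_ = U * ?Z")
proof (rule mat_eqI [of _ n n])
  have cU: "map_mat cnj U \<in> carrier_mat n n" and Z: "?Z \<in> carrier_mat n n" using U by simp_all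
  then show "Y * map_mat cnj U \<in> carrier_mat n n" "U * ?Z \<in> carrier_mat n n" using Y U by simp_all
  fix a b assume ab: "a < n" "b < n"
  let ?\<sigma> = "swap_outer p q"
  have "(U * ?Z) $$ (a, b) = (\<Sum>c<n. if c = ?\<sigma> b then - u a c * of_real (sinh (angle p q (\<lambda>a. 2 * t a) c)) else 0)"
    unfolding mult_mat_entry [OF U Z ab]
  proof (intro sum.cong refl)
    fix c assume "c \<in> {..<n}"
    moreover from this have "b = ?\<sigma> c \<longleftrightarrow> c = ?\<sigma> b"
      using swap_outer_swap_outer [OF qp, of c] swap_outer_swap_outer [OF qp, of b] ab by auto
    ultimately show "U $$ (a, c) * ?Z $$ (c, b)
        = (if c = ?\<sigma> b then - u a c * of_real (sinh (angle p q (\<lambda>a. 2 * t a) c)) else 0)"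
      using ab by (simp add: U_entry)
  qed
  also have "\<dots> = - u a (?\<sigma> b) * of_real (sinh (angle p q (\<lambda>a. 2 * t a) b))"
    using swap_outer_less [OF qp ab(2)] angle_swap_outer [OF qp ab(2)] by simp
  finally have UZ: "(U * ?Z) $$ (a, b) = - u a (?\<sigma> b) * of_real (sinh (angle p q (\<lambda>a. 2 * t a) b))" .
  have "(Y * map_mat cnj U) $$ (a, b) = (\<Sum>c<n. Y $$ (a, c) * cnj (u c b))"
    unfolding mult_mat_entry [OF Y cU ab] using ab U by (intro sum.cong) (simp_all add: U_entry)
  also have "\<dots> = - u a (?\<sigma> b) * of_real (sinh (angle p q (\<lambda>a. 2 * t a) b))"
  proof (cases "p \<le> b \<and> b < p + \<alpha>")
    case True
    have lt: "b - p < n" "b - p < p" using True ab \<alpha>_le qp by auto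
    have "(\<Sum>c<n. Y $$ (a, c) * cnj (u c b))
        = - (\<Sum>c<n. Y $$ (a, c) * cnj (Y $$ (c, b - p))) / of_real (s (b - p))"
      unfolding sum_divide_distrib sum_negf [symmetric] using True by (intro sum.cong) (auto simp: u_def)
    also have "\<dots> = - of_bool (a = b - p) * of_real (s (b - p))"
      using s_pos [of "b - p"] s_square [OF lt(1)] True
      by (auto simp: Y_square [OF ab(1) lt(1)] simp flip: s_square [OF lt(1)] simp del: of_real_diff)
    moreover have "?\<sigma> b = b - p" "angle p q (\<lambda>a. 2 * t a) b = 2 * t (b - p)"
      using True qp by (auto simp: swap_outer_def angle_def)
    ultimately show ?thesis using lt(2) by (simp add: u_def sinh_t)
  next
    case False
    obtain e where e: "e < n - \<alpha>" "\<And>a. u a b = of_bool (a = e)" "e = b \<and> b < p \<or> e = b - \<alpha> \<and> p + \<alpha> \<le> b"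
      using u_unit_column [OF ab(2) False] by metis
    have "(\<Sum>c<n. Y $$ (a, c) * cnj (u c b)) = Y $$ (a, e)"
      using e(1) by (simp add: e(2) of_bool_def if_distrib cong: if_cong)
    also have "\<dots> = - u a (?\<sigma> b) * of_real (sinh (angle p q (\<lambda>a. 2 * t a) b))"
    proof (cases "b < \<alpha>")
      case True
      then have "e = b" "b < q" "b < p" using e(3) \<alpha>_le qp by auto
      then show ?thesis
        using True s_pos [OF True] by (simp add: u_def swap_outer_def angle_def sinh_t)
    next
      \<comment> \<open>The eigenvalue is 1 or -1, so both the column of Y and the angle
        vanish.\<close>
      case nlt: False
      have "\<bar>d e\<bar> = 1" using e(3) nlt d_eq_1 [of b] d_eq_minus_1 [of e] e(1) by auto
      moreover have "sinh (angle p q (\<lambda>a. 2 * t a) b) = 0"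
      proof -
        have t0: "t c = 0" if "\<alpha> \<le> c" "c < p" for c
          using d_eq_1 [OF that] by (simp add: t_def)
        have "\<alpha> \<le> b - p \<and> b - p < p" if "p \<le> b"
          using that False ab qp by linarith
        then show ?thesis using nlt qp t0 [of b] t0 [of "b - p"] by (auto simp: angle_def)
      qed
      ultimately show ?thesis using Y_zero [of e a] e(1) ab by simp
    qed
    finally show ?thesis .
  qed
  finally show "(Y * map_mat cnj U) $$ (a, b) = (U * ?Z) $$ (a, b)" unfolding UZ .
qed

end

text \<open>Quaternions do not commute, but x y and y x have the same real part, so the real part of
  the trace is invariant under cyclic permutation.\<close>

definition re_trace :: "nat \<Rightarrow> quat mat \<Rightarrow> real" where
  "re_trace n A = (\<Sum>a<n. qRe (A $$ (a, a)))"

lemma re_trace_commute: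
  assumes "A \<in> carrier_mat n n" "B \<in> carrier_mat n n"
  shows "re_trace n (A * B) = re_trace n (B * A)"
proof -
  have "qRe (x * y) = qRe (y * x)" for x y by (simp add: times_quat_def)
  then have "(\<Sum>a<n. \<Sum>b<n. qRe (A $$ (a, b) * B $$ (b, a))) = (\<Sum>b<n. \<Sum>a<n. qRe (B $$ (b, a) * A $$ (a, b)))"
    by (subst sum.swap) (intro sum.cong refl)
  then show ?thesis
    by (simp add: re_trace_def mult_mat_entry [OF assms] mult_mat_entry [OF assms(2,1)] qRe_sum
        del: index_mult_mat(1))
qed

lemma re_trace_signature: "re_trace (p + q) (signature_mat p q) = real p - real q"
proof -
  have "re_trace (p + q) (signature_mat p q) = (\<Sum>a<p + q. block_sign p a)"
    by (simp add: re_trace_def signature_mat_def mat_diag_def of_real_def quat_defs)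
  also have "\<dots> = (\<Sum>a<p. block_sign p a) + (\<Sum>a\<in>{p..<p + q}. block_sign p a)"
    by (subst sum.union_disjoint [symmetric]) (auto intro!: sum.cong)
  finally show ?thesis by (simp add: block_sign_def)
qed

section \<open>From the paired basis to the factorization\<close>

context perp_unit
begin

lemma quat_orthogonal_mult:
  assumes "quat_orthogonal n A" "quat_orthogonal n B"
  shows "quat_orthogonal n (A * B)"
proof -
  note A = quat_orthogonalD [OF assms(1)] and B = quat_orthogonalD [OF assms(2)]
  have "quat_adjoint_i (A * B) * (A * B) = quat_adjoint_i B * (quat_adjoint_i A * A) * B"
    using A(1,2) B(1,2)
    by (simp add: quat_adjoint_i_mult [where n = n and m = n and k = n] mult_square_assoc [where n = n])
  also have "\<dots> = 1\<^sub>m n" unfolding A(3) using B by simp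
  finally show ?thesis using A(1) B(1) by (simp add: quat_orthogonal_def)
qed

lemma quat_orthogonal_adjoint:
  assumes "quat_orthogonal n A"
  shows "quat_orthogonal n (quat_adjoint_i A)"
  unfolding quat_orthogonal_def using quat_orthogonalD(2,4) [OF assms] by simp

lemma hyp_orthogonal: "q \<le> p \<Longrightarrow> quat_orthogonal (p + q) (hyp p q t)"
  unfolding quat_orthogonal_def by (simp add: quat_adjoint_i_hyp hyp_inverse(2))

text \<open>Commuting with the signature forces x = -x for each entry between indices of different
  sign; orthogonality is then read off block by block.\<close>

lemma block_diagI:
  assumes V: "quat_orthogonal (p + q) V"
    and comm: "V * signature_mat p q = signature_mat p q * V"
  obtains A D where "quat_orthogonal p A" "quat_orthogonal q D"
    "V = four_block_mat A (0\<^sub>m p q) (0\<^sub>m q p) D"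
proof -
  note V' = quat_orthogonalD [OF V]
  define A where "A = mat p p (\<lambda>ab. V $$ ab)"
  define D where "D = mat q q (\<lambda>(a, b). V $$ (p + a, p + b))"
  have A: "A \<in> carrier_mat p p" and D: "D \<in> carrier_mat q q" by (simp_all add: A_def D_def)
  have *: "V $$ (a, b) * of_real (block_sign p b) = of_real (block_sign p a) * V $$ (a, b)"
    if "a < p + q" "b < p + q" for a b
    using arg_cong [OF comm, of "\<lambda>M. M $$ (a, b)"] that
    unfolding signature_mat_def mat_diag_mult_left [OF V'(1)] mat_diag_mult_right [OF V'(1)] by simp
  have off: "V $$ (a, b) = 0" if "a < p + q" "b < p + q" "(a < p) \<noteq> (b < p)" for a b
  proof -
    have "x = 0" if "x = - x" for x :: quat
      using that by (cases x) (simp add: quat_defs)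
    with * [OF that(1,2)] that(3) show ?thesis
      by (auto simp: block_sign_def split: if_splits)
  qed
  have V_eq: "V = four_block_mat A (0\<^sub>m p q) (0\<^sub>m q p) D"
    by (rule mat_eqI [OF V'(1)]) (use off in \<open>auto simp: A_def D_def\<close>)
  have "four_block_mat (quat_adjoint_i A * A) (0\<^sub>m p q) (0\<^sub>m q p) (quat_adjoint_i D * D) = 1\<^sub>m (p + q)"
    using V'(3) unfolding V_eq quat_adjoint_i_block_diag_mult [OF A D] .
  then have entry: "four_block_mat (quat_adjoint_i A * A) (0\<^sub>m p q) (0\<^sub>m q p) (quat_adjoint_i D * D) $$ (a, b)
      = 1\<^sub>m (p + q) $$ (a, b)" for a b by simp
  have c: "quat_adjoint_i A * A \<in> carrier_mat p p" "quat_adjoint_i D * D \<in> carrier_mat q q"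
    using A D by simp_all
  have "quat_adjoint_i A * A = 1\<^sub>m p"
    by (rule mat_eqI [OF c(1) one_carrier_mat]) (use entry carrier_matD [OF c(1)] carrier_matD [OF c(2)] in
      \<open>metis (no_types, lifting) index_mat_four_block(1) index_one_mat(1) trans_less_add1\<close>)
  moreover have "quat_adjoint_i D * D = 1\<^sub>m q"
  proof (rule mat_eqI [OF c(2) one_carrier_mat])
    fix a b assume "a < q" "b < q"
    then show "(quat_adjoint_i D * D) $$ (a, b) = 1\<^sub>m q $$ (a, b)"
      using entry [of "p + a" "p + b"] carrier_matD [OF c(1)] carrier_matD [OF c(2)]
      by (simp del: index_mult_mat)
  qed
  ultimately show ?thesis using A D V_eq by (intro that [of A D]) (simp_all add: quat_orthogonal_def)
qed

text \<open>Two changes of basis are composed: W diagonalizes the first part of S, and the unitary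
  matrix of \<open>sorted_pairing\<close> then brings the second part to normal form while keeping
  the first diagonal.\<close>

lemma selfadjoint_involution_normal_form:
  assumes qp: "q \<le> p" and S: "S \<in> carrier_mat (p + q) (p + q)"
    and sq: "S * S = 1\<^sub>m (p + q)" and adj: "quat_adjoint_i S = S"
    and tr: "re_trace (p + q) S = real p - real q"
  obtains U t where "complex_unitary (p + q) U"
    "S * map_mat quat_of_complex U = map_mat quat_of_complex U * (hyp p q (\<lambda>a. 2 * t a) * signature_mat p q)"
proof -
  let ?n = "p + q"
  note [simp] = mult_square_assoc [where n = ?n] quat_adjoint_i_mult [where n = ?n and m = ?n and k = ?n]
  obtain X X' where X: "X \<in> carrier_mat ?n ?n" "X' \<in> carrier_mat ?n ?n" and S_eq: "S = pair_mat X X'"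
    using S by (rule pair_mat_obtain)
  have "mat_adjoint X = X"
    using adj X pair_mat_eq_iff [OF mat_adjoint_carrier [OF X(1)] transpose_carrier_mat [THEN iffD2, OF X(2)] X]
    by (simp add: S_eq quat_adjoint_i_pair_mat)
  then obtain W and d :: "nat \<Rightarrow> real" where Wu: "complex_unitary ?n W"
    and WX: "mat_adjoint W * X * W = mat_diag ?n (\<lambda>a. of_real (d a))"
    and sorted: "\<And>a b. a \<le> b \<Longrightarrow> b < ?n \<Longrightarrow> d b \<le> d a"
    using hermitian_diagonalize [OF X(1)] by metis
  note W = complex_unitaryD [OF Wu] and WQ = quat_orthogonalD [OF unitary_quat [OF Wu]]
  let ?W = "map_mat quat_of_complex W"
  define Y where "Y = mat_adjoint W * X' * map_mat cnj W"
  have Y: "Y \<in> carrier_mat ?n ?n" using W X by (simp add: Y_def)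
  define D where "D = mat_diag ?n (\<lambda>a. complex_of_real (d a))"
  have D: "D \<in> carrier_mat ?n ?n" by (simp add: D_def)
  \<comment> \<open>T is S in the eigenbasis of X. It inherits the involution, self-adjointness and
    trace conditions, which are the assumptions of the locale.\<close>
  define T where "T = quat_adjoint_i ?W * S * ?W"
  have T: "T \<in> carrier_mat ?n ?n" using WQ S by (simp add: T_def)
  have "quat_adjoint_i (map_mat quat_of_complex (mat_adjoint W)) = ?W"
    using W by (simp flip: quat_adjoint_i_of_complex [OF W(1)])
  then have T_eq: "T = pair_mat D Y"
    using unitary_conj_pair_mat [OF W(2) X] by (simp add: T_def S_eq quat_adjoint_i_of_complex [OF W(1)] Y_def D_def flip: WX)
  have "T * T = quat_adjoint_i ?W * S * (?W * quat_adjoint_i ?W) * S * ?W"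
    unfolding T_def using WQ(1,2) S by simp
  also have "\<dots> = quat_adjoint_i ?W * (S * S) * ?W"
    unfolding WQ(4) using WQ(1,2) S by simp
  finally have TT: "T * T = 1\<^sub>m ?n" unfolding sq using WQ by simp
  have T_adj: "quat_adjoint_i T = T"
    unfolding T_def using WQ(1,2) S by (simp add: adj)
  have "mat_adjoint D = D \<and> transpose_mat Y = Y"
    using T_adj D Y unfolding T_eq quat_adjoint_i_pair_mat [OF D Y]
    by (subst (asm) pair_mat_eq_iff [where n = ?n and m = ?n]) auto
  then have Y_sym: "Y $$ (a, b) = Y $$ (b, a)" if "a < ?n" "b < ?n" for a b
    using that Y by (metis carrier_matD index_transpose_mat(1))
  have cY: "map_mat cnj Y \<in> carrier_mat ?n ?n" and cD: "map_mat cnj D \<in> carrier_mat ?n ?n" using Y D by simp_all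
  have "pair_mat (D * D - Y * map_mat cnj Y) (D * Y + Y * map_mat cnj D) = pair_mat (1\<^sub>m ?n) (0\<^sub>m ?n ?n)"
    using TT unfolding T_eq pair_mat_mult [OF D Y D Y] pair_mat_one .
  then have eqs: "D * D - Y * map_mat cnj Y = 1\<^sub>m ?n" "D * Y + Y * map_mat cnj D = 0\<^sub>m ?n ?n"
    using D Y cY cD by (subst (asm) pair_mat_eq_iff [where n = ?n and m = ?n]; auto)+
  interpret sorted_pairing p q d Y
  proof
    fix a b assume ab: "a < ?n" "b < ?n"
    show "Y $$ (a, b) = Y $$ (b, a)" using Y_sym ab by blast
    have "(\<Sum>c<?n. Y $$ (a, c) * cnj (Y $$ (c, b))) = (Y * map_mat cnj Y) $$ (a, b)"
      unfolding mult_mat_entry [OF Y cY ab] using ab Y by (intro sum.cong) auto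
    also have "\<dots> = (D * D) $$ (a, b) - (D * D - Y * map_mat cnj Y) $$ (a, b)"
      using ab Y D by simp
    also have "\<dots> = (if a = b then of_real ((d a)\<^sup>2 - 1) else 0)"
      unfolding eqs unfolding D_def mat_diag_diag using ab by (simp add: mat_diag_def power2_eq_square)
    finally show "(\<Sum>c<?n. Y $$ (a, c) * cnj (Y $$ (c, b))) = (if a = b then of_real ((d a)\<^sup>2 - 1) else 0)" .
    have cD': "map_mat cnj D = D" by (rule mat_eqI [OF cD D]) (auto simp: D_def mat_diag_def)
    have "(D * Y + Y * map_mat cnj D) $$ (a, b) = of_real (d a) * Y $$ (a, b) + Y $$ (a, b) * of_real (d b)"
      unfolding cD' unfolding D_def mat_diag_mult_left [OF Y] mat_diag_mult_right [OF Y] using ab by simp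
    then have "of_real (d a + d b) * Y $$ (a, b) = 0"
      unfolding eqs using ab by (simp add: algebra_simps)
    then show "d b = - d a" if "Y $$ (a, b) \<noteq> 0"
      using that by (simp del: of_real_add)
  next
    have "(\<Sum>a<?n. d a) = re_trace ?n T"
      using D by (simp add: re_trace_def T_eq pair_mat_def qRe_pair) (simp add: D_def mat_diag_def)
    also have "\<dots> = re_trace ?n (quat_adjoint_i ?W * (S * ?W))"
      unfolding T_def using WQ(1,2) S by simp
    also have "\<dots> = re_trace ?n (S * (?W * quat_adjoint_i ?W))"
      using WQ(1,2) S by (subst re_trace_commute) auto
    finally show "(\<Sum>a<?n. d a) = real p - real q"
      unfolding WQ(4) using S by (simp add: tr)
  qed (use sorted Y qp in auto)
  note U = complex_unitaryD [OF U_unitary] and UQ = quat_orthogonalD [OF unitary_quat [OF U_unitary]]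
  let ?U = "map_mat quat_of_complex U"
  let ?d = "mat_diag ?n (\<lambda>a. complex_of_real (block_sign p a * cosh (angle p q (\<lambda>a. 2 * t a) a)))"
  let ?Z = "mat ?n ?n (\<lambda>(a, b). if b = swap_outer p q a then - complex_of_real (sinh (angle p q (\<lambda>a. 2 * t a) a)) else 0)"
  have Z: "?d \<in> carrier_mat ?n ?n" "?Z \<in> carrier_mat ?n ?n" by simp_all
  have "T * ?U = pair_mat (D * U) (Y * map_mat cnj U)"
    unfolding T_eq using U(1) D Y by (rule pair_mat_mult_of_complex)
  also have "\<dots> = pair_mat (U * ?d) (U * ?Z)" unfolding D_def diag_U Y_U ..
  also have "\<dots> = ?U * pair_mat ?d ?Z"
    using U(1) Z by (rule of_complex_mult_pair_mat [symmetric])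
  finally have TU: "T * ?U = ?U * (hyp p q (\<lambda>a. 2 * t a) * signature_mat p q)"
    unfolding hyp_signature_pair [OF qp] .
  have "S * ?W * ?U = (?W * quat_adjoint_i ?W) * S * ?W * ?U"
    unfolding WQ(4) using S WQ(1) UQ(1) by simp
  also have "\<dots> = ?W * (T * ?U)" unfolding T_def using S WQ(1,2) UQ(1) by simp
  finally have "S * (?W * ?U) = ?W * ?U * (hyp p q (\<lambda>a. 2 * t a) * signature_mat p q)"
    unfolding TU using S WQ(1) UQ(1) by simp
  then show ?thesis
    using complex_unitary_mult [OF Wu U_unitary] W(1) U(1)
    by (intro that [of "W * U" t]) (simp_all add: map_quat_of_complex_mult [where n = ?n and m = ?n and k = ?n])
qed

lemma hyperbolic_factorization_exists:
  assumes qp: "q \<le> p" and M: "quat_orthogonal (p + q) M"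
  shows "\<exists>\<theta> U V\<^sub>p V\<^sub>q. hyperbolic_factorization p q \<eta> M U \<theta> V\<^sub>p V\<^sub>q"
proof -
  let ?n = "p + q" and ?J = "signature_mat p q"
  note [simp] = mult_square_assoc [where n = ?n] quat_adjoint_i_mult [where n = ?n and m = ?n and k = ?n]
  note M' = quat_orthogonalD [OF M]
  define S where "S = M * ?J * quat_adjoint_i M"
  have S: "S \<in> carrier_mat ?n ?n" using M' by (simp add: S_def)
  have "S * S = M * ?J * (quat_adjoint_i M * M) * ?J * quat_adjoint_i M"
    unfolding S_def using M'(1,2) by simp
  also have "\<dots> = M * (?J * ?J) * quat_adjoint_i M"
    unfolding M'(3) using M'(1,2) by simp
  finally have SS: "S * S = 1\<^sub>m ?n" unfolding signature_mat_square using M' by simp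
  have adj: "quat_adjoint_i S = S"
    unfolding S_def using M'(1,2) by (simp add: quat_adjoint_i_signature_mat)
  \<comment> \<open>Cyclic invariance moves the adjoint of M next to M, leaving the trace of the
    signature.\<close>
  have "re_trace ?n S = re_trace ?n (?J * (quat_adjoint_i M * M))"
    unfolding S_def using M'(1,2) by (simp, subst re_trace_commute) auto
  also have "\<dots> = real p - real q"
    unfolding M'(3) by (simp add: re_trace_signature)
  finally obtain U t where Uu: "complex_unitary ?n U"
    and SU: "S * map_mat quat_of_complex U = map_mat quat_of_complex U * (hyp p q (\<lambda>a. 2 * t a) * ?J)"
    using selfadjoint_involution_normal_form [OF qp S SS adj] by blast
  let ?U = "map_mat quat_of_complex U"
  let ?H = "hyp p q t" and ?H' = "hyp p q (\<lambda>a. - t a)"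
  note UQ = quat_orthogonalD [OF unitary_quat [OF Uu]]
  \<comment> \<open>The factorization is solved for its last factor; it remains to see that V is
    block diagonal.\<close>
  define V where "V = ?H' * quat_adjoint_i ?U * M"
  have V: "quat_orthogonal ?n V"
    unfolding V_def by (intro quat_orthogonal_mult hyp_orthogonal quat_orthogonal_adjoint unitary_quat Uu M qp)
  note V' = quat_orthogonalD [OF V]
  have "V * ?J * quat_adjoint_i V = ?H' * quat_adjoint_i ?U * (S * ?U) * quat_adjoint_i ?H'"
    unfolding V_def S_def using M'(1,2) UQ(1,2) by simp
  also have "\<dots> = ?H' * (quat_adjoint_i ?U * ?U) * (hyp p q (\<lambda>a. 2 * t a) * ?J) * quat_adjoint_i ?H'"
    unfolding SU using UQ(1,2) by simp
  also have "\<dots> = ?H' * (?H * ?J * ?H') * ?H"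
    unfolding UQ(3) hyp_conj_signature [OF qp] using qp by (simp add: quat_adjoint_i_hyp)
  also have "\<dots> = (?H' * ?H) * ?J * (?H' * ?H)" by simp
  also have "\<dots> = ?J" unfolding hyp_inverse [OF qp] by simp
  finally have VJ: "V * ?J * quat_adjoint_i V = ?J" .
  have "V * ?J = V * ?J * (quat_adjoint_i V * V)" unfolding V'(3) using V'(1) by simp
  also have "\<dots> = V * ?J * quat_adjoint_i V * V" using V'(1,2) by simp
  finally have "V * ?J = ?J * V" unfolding VJ .
  then obtain V\<^sub>p V\<^sub>q where blocks: "quat_orthogonal p V\<^sub>p" "quat_orthogonal q V\<^sub>q"
    "V = four_block_mat V\<^sub>p (0\<^sub>m p q) (0\<^sub>m q p) V\<^sub>q"
    using block_diagI [OF V] by blast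
  have "?U * ?H * V = ?U * (?H * ?H') * quat_adjoint_i ?U * M"
    unfolding V_def using UQ(1,2) M'(1) by simp
  also have "\<dots> = M" unfolding hyp_inverse [OF qp] using UQ M' by simp
  finally have "M = ?U * ?H * V" ..
  \<comment> \<open>\<open>hyp\<close> reads its angle function only below q, so t may be cut down
    to a vector of length q.\<close>
  moreover have "?H = hyp p q (\<lambda>a. vec q t $ a)"
    unfolding hyp_def by (rule cross_mat_cong) (auto simp: angle_def)
  ultimately have "hyperbolic_factorization p q \<eta> M U (vec q t) V\<^sub>p V\<^sub>q"
    using Uu blocks by (simp add: hyperbolic_factorization_def hyperbolic_mat_eq_hyp [OF qp])
  then show ?thesis by blast
qed

end

theorem theorem8p5:
  fixes n p q :: nat and \<eta> :: quat and M :: "quat mat"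
  assumes "n = p + q" and "p \<ge> q"
    and "\<eta> \<in> {quat_j, quat_k}"
    and "quat_orthogonal n M"
  shows "\<exists>\<theta>. (\<exists>U V\<^sub>p V\<^sub>q. hyperbolic_factorization p q \<eta> M U \<theta> V\<^sub>p V\<^sub>q) \<and>
    (\<forall>\<theta>' U' V\<^sub>p' V\<^sub>q'. hyperbolic_factorization p q \<eta> M U' \<theta>' V\<^sub>p' V\<^sub>q' \<longrightarrow>
       eq_up_to_order_and_signs q \<theta> \<theta>')"
proof -
  interpret perp_unit \<eta> using assms(3) by unfold_locales
  show ?thesis
    using hyperbolic_factorization_exists [OF assms(2)] angles_unique [OF assms(2)] assms(1,4) by meson
qed

end
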